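(* Let $n\ge 4$, let $x_0<x_1<\dots<x_n$ be real numbers, let $f:[x_0,x_n]\to\mathbb{R}$ be four times continuously differentiable, and set $h:=\max_{1\le i\le n}(x_i-x_{i-1})$ and $\|f^{(4)}\|_\infty:=\max_{\xi\in[x_0,x_n]}|f^{(4)}(\xi)|$. Define $$\|f^{(5)}\|_\infty:=\begin{cases}\infty & \text{if the fifth derivative of } f \text{ is not continuous},\\ \max_{x\in[x_0,x_4]\cup[x_{n-4},x_n]}|f^{(5)}(x)| & \text{else,}\end{cases}$$ where, if $f^{(5)}$ does not exist, it is interpreted as not continuous. Let $s$ be the Q-spline for $f$ on the knots $x_0,\dots,x_n$, i.e. the interpolating cubic spline with $s(x_i)=f(x_i)$ for $0\le i\le n$, $s''(x_0)=p''(x_0)$ and $s''(x_n)=q''(x_n)$, where $p$ is the polynomial of degree at most $4$ interpolating $f$ at $x_0,x_1,x_2,x_3,x_4$ and $q$ is the polynomial of degree at most $4$ interpolating $f$ at $x_{n-4},x_{n-3},x_{n-2},x_{n-1},x_n$. Then for all $x\in[x_0,x_n]$ $$|s(x)-f(x)|\le\left(\tfrac{5}{384}+\tfrac{R}{8}\right)\|f^{(4)}\|_\infty h^4,$$ where $$R=\min\left\{\tfrac{11}{6},\ \frac{5h\,\|f^{(5)}\|_\infty}{12\,\|f^{(4)}\|_\infty}\right\}.$$ (If $\|f^{(4)}\|_\infty=0$, then also $\|f^{(5)}\|_\infty=0$ and the ratio $\frac{5h\|f^{(5)}\|_\infty}{12\|f^{(4)}\|_\infty}$ is replaced with $0$.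)
   Context: A cubic spline on the knots $x_0<\dots<x_n$ is a function $s\in C^2([x_0,x_n])$ whose restriction to each interval $[x_{i-1},x_i]$, $1\le i\le n$, is a polynomial of degree at most $3$. Given interpolation values at all knots and prescribed values of $s''(x_0)$ and $s''(x_n)$, such a spline exists and is unique. If $\|f^{(5)}\|_\infty=\infty$, the minimum defining $R$ is $\tfrac{11}{6}$. *)

theory Defs
  imports "HOL-Analysis.Analysis" "HOL-Computational_Algebra.Polynomial"
begin

text \<open>Derivatives are taken within \<open>S\<close>, hence are one-sided at the end points of a closed
  interval, and the values of \<open>f\<close> outside \<open>S\<close> play no role.\<close>

definition nth_deriv_within :: "real set \<Rightarrow> nat \<Rightarrow> (real \<Rightarrow> real) \<Rightarrow> real \<Rightarrow> real" where
  "nth_deriv_within S k f = ((\<lambda>g t. vector_derivative g (at t within S)) ^^ k) f"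

definition C_k_on :: "nat \<Rightarrow> (real \<Rightarrow> real) \<Rightarrow> real set \<Rightarrow> bool" where
  "C_k_on k f S \<longleftrightarrow>
     (\<forall>j<k. nth_deriv_within S j f differentiable_on S) \<and>
     continuous_on S (nth_deriv_within S k f)"

definition cubic_spline :: "nat \<Rightarrow> (nat \<Rightarrow> real) \<Rightarrow> (real \<Rightarrow> real) \<Rightarrow> bool" where
  "cubic_spline n x s \<longleftrightarrow>
     C_k_on 2 s {x 0..x n} \<and>
     (\<forall>i\<in>{1..n}. \<exists>p :: real poly. degree p \<le> 3 \<and> (\<forall>t\<in>{x (i - 1)..x i}. s t = poly p t))"

definition interpolating_poly ::
    "nat \<Rightarrow> nat set \<Rightarrow> (nat \<Rightarrow> real) \<Rightarrow> (real \<Rightarrow> real) \<Rightarrow> real poly \<Rightarrow> bool" where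
  "interpolating_poly d I x f p \<longleftrightarrow> degree p \<le> d \<and> (\<forall>i\<in>I. poly p (x i) = f (x i))"

text \<open>The polynomials \<open>p\<close> and \<open>q\<close> below are unique whenever the knots are distinct and
  \<open>n \<ge> 4\<close>, so the existential quantifier just names them.\<close>

definition Q_spline :: "nat \<Rightarrow> (nat \<Rightarrow> real) \<Rightarrow> (real \<Rightarrow> real) \<Rightarrow> (real \<Rightarrow> real) \<Rightarrow> bool" where
  "Q_spline n x f s \<longleftrightarrow>
     cubic_spline n x s \<and>
     (\<forall>i\<le>n. s (x i) = f (x i)) \<and>
     (\<exists>p q. interpolating_poly 4 {0..4} x f p \<and>
            interpolating_poly 4 {n - 4..n} x f q \<and>
            nth_deriv_within {x 0..x n} 2 s (x 0) = poly (pderiv (pderiv p)) (x 0) \<and>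
            nth_deriv_within {x 0..x n} 2 s (x n) = poly (pderiv (pderiv q)) (x n))"

definition mesh :: "nat \<Rightarrow> (nat \<Rightarrow> real) \<Rightarrow> real" where
  "mesh n x = Max ((\<lambda>i. x i - x (i - 1)) ` {1..n})"

text \<open>The suprema below are maxima: in each case a continuous function is considered on a
  nonempty compact set.\<close>

definition norm_deriv4 :: "nat \<Rightarrow> (nat \<Rightarrow> real) \<Rightarrow> (real \<Rightarrow> real) \<Rightarrow> real" where
  "norm_deriv4 n x f = (SUP t\<in>{x 0..x n}. \<bar>nth_deriv_within {x 0..x n} 4 f t\<bar>)"

definition norm_deriv5 :: "nat \<Rightarrow> (nat \<Rightarrow> real) \<Rightarrow> (real \<Rightarrow> real) \<Rightarrow> ereal" where
  "norm_deriv5 n x f =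
     (if C_k_on 5 f {x 0..x n}
      then ereal (SUP t\<in>{x 0..x 4} \<union> {x (n - 4)..x n}. \<bar>nth_deriv_within {x 0..x n} 5 f t\<bar>)
      else \<infinity>)"

text \<open>The minimum is taken in the extended reals; it is at most \<open>11/6\<close> and nonnegative,
  hence finite.\<close>

definition R_const :: "nat \<Rightarrow> (nat \<Rightarrow> real) \<Rightarrow> (real \<Rightarrow> real) \<Rightarrow> real" where
  "R_const n x f =
     real_of_ereal (min (ereal (11 / 6))
       (if norm_deriv4 n x f = 0 then 0
        else ereal (5 * mesh n x) * norm_deriv5 n x f / ereal (12 * norm_deriv4 n x f)))"

end

theory Submission
  imports Defs
begin

text \<open>On each cell compare \<open>s\<close> and \<open>f\<close> with the cubic Hermite interpolant
  of \<open>f\<close>: the latter is within \<open>M h^4 / 384\<close> of \<open>f\<close>, where \<open>M\<close>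
  bounds the fourth derivative, and differs from \<open>s\<close> by the Hermite cubic of the slope errors
  \<open>e i = s' (x i) - f' (x i)\<close>. Continuity of \<open>s''\<close> gives a diagonally dominant system for the
  \<open>e i\<close>. If \<open>s''\<close> were exact at both ends, it would yield \<open>\<bar>e i\<bar> \<le> M h^3 / 24\<close>,
  hence the constant \<open>1/384 + 1/96 = 5/384\<close>.

  The errors of \<open>s''\<close> at the ends, bounded by some \<open>D\<close>, are split off as a cubic spline vanishing at
  all knots. Its second derivatives alternate in sign and at least halve from knot to knot, so that
  it is bounded by \<open>D h^2 / 16\<close> instead of the obvious \<open>D h^2 / 8\<close>. The missing factor
  is needed: for quartic interpolation \<open>D\<close> can be as large as \<open>(5/6) h^3\<close> times the norm of the
  fifth derivative, twice the constant \<open>5/12\<close> in \<open>R\<close>.\<close>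

section \<open>Families of successive one-sided derivatives\<close>

text \<open>An explicit family, not the iterates of an operator tied to one set: chains pass to
  subintervals, and the derivatives of a polynomial can be subtracted termwise, as the Rolle
  arguments below require.\<close>

definition deriv_chain :: "nat \<Rightarrow> (nat \<Rightarrow> real \<Rightarrow> real) \<Rightarrow> real set \<Rightarrow> bool" where
  "deriv_chain m F S \<longleftrightarrow>
     (\<forall>j<m. \<forall>t\<in>S. (F j has_real_derivative F (Suc j) t) (at t within S))"

lemma deriv_chain_subset: "deriv_chain m F S \<Longrightarrow> T \<subseteq> S \<Longrightarrow> deriv_chain m F T"
  unfolding deriv_chain_def by (meson DERIV_subset subsetD)

lemma deriv_chain_diff_poly:
  assumes "deriv_chain m F S"
  shows "deriv_chain m (\<lambda>j t. F j t - poly ((pderiv ^^ j) P) t) S"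
  using assms unfolding deriv_chain_def
  by (auto intro!: DERIV_diff has_field_derivative_at_within[OF poly_DERIV])

lemma deriv_chain_nth_deriv_within:
  assumes "C_k_on m f S"
  shows "deriv_chain m (\<lambda>j. nth_deriv_within S j f) S"
  unfolding deriv_chain_def
proof (intro allI impI ballI)
  fix j t assume "j < m" "t \<in> S"
  then have "nth_deriv_within S j f differentiable (at t within S)"
    using assms by (auto simp: C_k_on_def differentiable_on_def)
  then have "(nth_deriv_within S j f has_vector_derivative
      vector_derivative (nth_deriv_within S j f) (at t within S)) (at t within S)"
    using vector_derivative_works by blast
  then show "(nth_deriv_within S j f has_real_derivative nth_deriv_within S (Suc j) f t) (at t within S)"
    by (simp add: has_real_derivative_iff_has_vector_derivative nth_deriv_within_def)
qed

lemma nth_deriv_within_le_Sup: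
  assumes "continuous_on T (nth_deriv_within S m f)" "compact T" "t \<in> T"
  shows "\<bar>nth_deriv_within S m f t\<bar> \<le> (SUP t\<in>T. \<bar>nth_deriv_within S m f t\<bar>)"
proof -
  have "compact ((\<lambda>t. \<bar>nth_deriv_within S m f t\<bar>) ` T)"
    using assms by (intro compact_continuous_image continuous_intros)
  then show ?thesis
    using assms by (intro cSUP_upper) (auto simp: compact_imp_bounded bounded_imp_bdd_above)
qed

lemma poly_higher_pderiv_degree:
  fixes P :: "real poly"
  assumes "degree P \<le> m"
  shows "poly ((pderiv ^^ m) P) t = fact m * coeff P m"
proof -
  have "degree ((pderiv ^^ m) P) = 0"
    using assms by (simp add: degree_higher_pderiv)
  then obtain c where "(pderiv ^^ m) P = [:c:]"
    by (metis degree_0_id)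
  moreover have "coeff ((pderiv ^^ m) P) 0 = fact m * coeff P m"
    by (simp add: coeff_higher_pderiv pochhammer_fact)
  ultimately show ?thesis by simp
qed

section \<open>Counting zeros with Rolle's theorem\<close>

lemma Rolle_within:
  fixes f :: "real \<Rightarrow> real"
  assumes "a < b" "f a = f b" "\<And>t. t \<in> {a..b} \<Longrightarrow> (f has_real_derivative f' t) (at t within {a..b})"
  shows "\<exists>z. a < z \<and> z < b \<and> f' z = 0"
proof -
  have "continuous_on {a..b} f"
    using assms(3) by (rule DERIV_continuous_on)
  moreover have "(f has_real_derivative f' t) (at t)" if "a < t" "t < b" for t
    using assms(3)[of t] that by (simp add: at_within_Icc_at)
  ultimately obtain z where "a < z" "z < b" "(\<lambda>v. f' z * v) = (\<lambda>v. 0)"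
    using Rolle_deriv[of a b f "\<lambda>t v. f' t * v"] assms(1,2)
    by (auto simp: has_field_derivative_def)
  moreover then have "f' z = 0"
    by (metis mult.right_neutral)
  ultimately show ?thesis by blast
qed

text \<open>Cut off the largest zero \<open>z\<close>: Rolle between it and the next largest zero
  \<open>y\<close> yields a zero of \<open>f'\<close> to the right of \<open>y\<close>, and the
  induction hypothesis on \<open>{a..y}\<close> yields the others to its left. Hence
  \<open>b\<close> varies in the induction.\<close>

lemma Rolle_card:
  fixes f :: "real \<Rightarrow> real"
  assumes "\<And>t. t \<in> {a..b} \<Longrightarrow> (f has_real_derivative f' t) (at t within {a..b})"
    and "finite Z" "Z \<subseteq> {a..b}" "\<And>z. z \<in> Z \<Longrightarrow> f z = 0" "card Z = Suc r"
  shows "\<exists>Z'. finite Z' \<and> Z' \<subseteq> {a<..<b} \<and> (\<forall>z\<in>Z'. f' z = 0) \<and> card Z' = r"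
  using assms
proof (induction r arbitrary: b Z)
  case 0
  then show ?case by (intro exI[of _ "{}"]) auto
next
  case (Suc r)
  define z where "z = Max Z"
  define Y where "Y = Z - {z}"
  define y where "y = Max Y"
  have ne: "Z \<noteq> {}" using Suc.prems by auto
  then have z: "z \<in> Z" "\<And>w. w \<in> Z \<Longrightarrow> w \<le> z" using Suc.prems by (auto simp: z_def)
  have cY: "card Y = Suc r" "finite Y" using Suc.prems z by (auto simp: Y_def)
  then have "Y \<noteq> {}" by auto
  then have y: "y \<in> Y" "\<And>w. w \<in> Y \<Longrightarrow> w \<le> y" using cY by (auto simp: y_def)
  have "y < z" using y z by (force simp: Y_def)
  have yz: "a \<le> y" "z \<le> b" using y z Suc.prems by (auto simp: Y_def)
  have der: "(f has_real_derivative f' t) (at t within {c..d})"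
    if "t \<in> {c..d}" "a \<le> c" "d \<le> b" for t c d
    using Suc.prems(1)[of t] that by (auto intro: DERIV_subset)
  have "\<exists>Z'. finite Z' \<and> Z' \<subseteq> {a<..<y} \<and> (\<forall>z\<in>Z'. f' z = 0) \<and> card Z' = r"
  proof (rule Suc.IH)
    show "Y \<subseteq> {a..y}" using y(2) Suc.prems(3) by (force simp: Y_def)
    show "(f has_real_derivative f' t) (at t within {a..y})" if "t \<in> {a..y}" for t
      using der[of t a y] that \<open>y < z\<close> yz by auto
  qed (use cY Suc.prems in \<open>auto simp: Y_def\<close>)
  then obtain Z' where Z': "finite Z'" "Z' \<subseteq> {a<..<y}" "\<forall>z\<in>Z'. f' z = 0" "card Z' = r"
    by blast
  have "\<exists>w. y < w \<and> w < z \<and> f' w = 0"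
  proof (rule Rolle_within)
    show "f y = f z" using y z Suc.prems by (auto simp: Y_def)
    show "(f has_real_derivative f' t) (at t within {y..z})" if "t \<in> {y..z}" for t
      using der[of t y z] that yz by auto
  qed fact
  then obtain w where w: "y < w" "w < z" "f' w = 0" by blast
  have "w \<notin> Z'" using Z'(2) w by auto
  then show ?case
    using Z' w yz \<open>y < z\<close> by (intro exI[of _ "insert w Z'"]) (auto simp: subset_iff)
qed

text \<open>The new zeros avoid the end points, so zeros of the derivative known at \<open>a\<close>
  or \<open>b\<close> can be added without being counted twice.\<close>

lemma Rolle_chain_step:
  assumes F: "deriv_chain m F {a..b}" "j < m"
    and Z: "finite Z" "Z \<subseteq> {a..b}" "\<And>z. z \<in> Z \<Longrightarrow> F j z = 0" "card Z = Suc r"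
  obtains Z' where "finite Z'" "Z' \<subseteq> {a..b}" "a \<notin> Z'" "b \<notin> Z'"
    "\<And>z. z \<in> Z' \<Longrightarrow> F (Suc j) z = 0" "card Z' = r"
proof -
  have "\<And>t. t \<in> {a..b} \<Longrightarrow> (F j has_real_derivative F (Suc j) t) (at t within {a..b})"
    using F by (auto simp: deriv_chain_def)
  from Rolle_card[OF this Z]
  obtain Z' where Z': "finite Z'" "Z' \<subseteq> {a<..<b}" "\<forall>z\<in>Z'. F (Suc j) z = 0" "card Z' = r"
    by auto
  have "{a<..<b} \<subseteq> {a..b}" "a \<notin> {a<..<b}" "b \<notin> {a<..<b}" by auto
  with Z'(2) have "Z' \<subseteq> {a..b}" "a \<notin> Z'" "b \<notin> Z'" by blast+
  with Z' show ?thesis using that[of Z'] by blast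
qed

lemma Rolle_chain:
  assumes "deriv_chain m F {a..b}" "j + r \<le> m"
    and "finite Z" "Z \<subseteq> {a..b}" "\<And>z. z \<in> Z \<Longrightarrow> F j z = 0" "card Z = Suc r"
  shows "\<exists>z\<in>{a..b}. F (j + r) z = 0"
  using assms
proof (induction r arbitrary: j Z)
  case 0
  then obtain z where "Z = {z}" by (auto simp: card_Suc_eq)
  with 0 show ?case by auto
next
  case (Suc r)
  have "j < m" using Suc.prems(2) by simp
  then obtain Z' where Z': "finite Z'" "Z' \<subseteq> {a..b}" "\<And>z. z \<in> Z' \<Longrightarrow> F (Suc j) z = 0" "card Z' = Suc r"
    by (rule Rolle_chain_step[OF Suc.prems(1) _ Suc.prems(3-6)]) auto
  then show ?case
    using Suc.IH[of "Suc j" Z'] Suc.prems(1,2) Z' by auto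
qed

section \<open>Interpolation errors\<close>

text \<open>\<open>W\<close> is the monic nodal polynomial, and \<open>c\<close> is chosen such that
  the error \<open>G\<close> of \<open>P + c W\<close> also satisfies \<open>G 2 y = 0\<close>. The
  \<open>m\<close> nodes leave \<open>m - 2\<close> interior zeros of \<open>G 2\<close>; the end
  point \<open>y\<close> is one more, and \<open>m - 2\<close> further derivatives lead to a zero of
  \<open>G m\<close>. The \<open>m\<close>-th derivative of \<open>P\<close> is kept because a
  quartic \<open>P\<close> will be used with only four nodes.\<close>

lemma interpolation_deriv2_remainder:
  fixes P W :: "real poly"
  assumes F: "deriv_chain m F {a..b}" and m: "3 \<le> m"
    and Z: "finite Z" "Z \<subseteq> {a..b}" "card Z = m"
    and int: "\<And>z. z \<in> Z \<Longrightarrow> F 0 z = poly P z" "\<And>z. z \<in> Z \<Longrightarrow> poly W z = 0"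
    and W: "degree W \<le> m" "coeff W m = 1" "poly (pderiv (pderiv W)) y \<noteq> 0"
    and y: "y = a \<or> y = b" and ab: "a \<le> b"
  shows "\<exists>z\<in>{a..b}. fact m * (F 2 y - poly (pderiv (pderiv P)) y) =
    poly (pderiv (pderiv W)) y * (F m z - poly ((pderiv ^^ m) P) z)"
proof -
  define c where "c = (F 2 y - poly (pderiv (pderiv P)) y) / poly (pderiv (pderiv W)) y"
  define G where "G = (\<lambda>j t. F j t - poly ((pderiv ^^ j) (P + smult c W)) t)"
  have G: "deriv_chain m G {a..b}"
    unfolding G_def by (rule deriv_chain_diff_poly[OF F])
  define r where "r = m - 3"
  then have r: "m = Suc (Suc (Suc r))" using m by simp
  have G0: "G 0 z = 0" if "z \<in> Z" for z using int that by (simp add: G_def)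
  obtain Z1 where Z1: "finite Z1" "Z1 \<subseteq> {a..b}"
      "\<And>z. z \<in> Z1 \<Longrightarrow> G (Suc 0) z = 0" "card Z1 = Suc (Suc r)"
    by (rule Rolle_chain_step[OF G _ Z(1,2) G0 Z(3)[unfolded r]]) (use m in auto)
  obtain Z2 where Z2: "finite Z2" "Z2 \<subseteq> {a..b}" "a \<notin> Z2" "b \<notin> Z2"
      "\<And>z. z \<in> Z2 \<Longrightarrow> G (Suc (Suc 0)) z = 0" "card Z2 = Suc r"
    by (rule Rolle_chain_step[OF G _ Z1]) (use m in auto)
  have "G 2 y = 0"
    using W(3) by (simp add: G_def c_def numeral_2_eq_2 pderiv_add pderiv_smult)
  moreover have "y \<notin> Z2" using Z2(3,4) y by auto
  ultimately have "\<exists>z\<in>{a..b}. G (Suc (Suc 0) + Suc r) z = 0"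
    using Z2 y r ab by (intro Rolle_chain[OF G, where Z = "insert y Z2"]) (auto simp: numeral_2_eq_2)
  then obtain z where z: "z \<in> {a..b}" "G m z = 0" using r by auto
  have "(pderiv ^^ m) (P + smult c W) = (pderiv ^^ m) P + smult c ((pderiv ^^ m) W)"
    by (simp add: higher_pderiv_add higher_pderiv_smult)
  then have "F m z - poly ((pderiv ^^ m) P) z = c * fact m"
    using z(2) poly_higher_pderiv_degree[OF W(1)] W(2) by (simp add: G_def)
  then show ?thesis
    using z(1) W(3) by (intro bexI[of _ z]) (simp_all add: c_def)
qed

text \<open>A multiple \<open>c\<close> of the quartic \<open>W\<close> with double zeros at both
  ends is added to \<open>U\<close> to force one more zero of the error or of its second derivative;
  Rolle then gives \<open>24 * c = F 4 z\<close>. On the interval \<open>W\<close> is at most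
  \<open>(b - a) ^ 4 / 16\<close>, and its second derivative at the ends is
  \<open>2 * (b - a)\<^sup>2\<close>, whence the denominators \<open>384\<close> and
  \<open>12\<close>.\<close>

lemma hermite_remainder:
  fixes U :: "real poly"
  assumes F: "deriv_chain 4 F {a..b}" and ab: "a < b"
    and M: "\<And>t. t \<in> {a..b} \<Longrightarrow> \<bar>F 4 t\<bar> \<le> M"
    and U: "degree U \<le> 3" "poly U a = F 0 a" "poly U b = F 0 b"
      "poly (pderiv U) a = F 1 a" "poly (pderiv U) b = F 1 b"
  shows hermite_remainder_value:
      "t \<in> {a..b} \<Longrightarrow> \<bar>poly U t - F 0 t\<bar> \<le> M * (b - a) ^ 4 / 384"
    and hermite_remainder_deriv2:
      "y = a \<or> y = b \<Longrightarrow> \<bar>poly (pderiv (pderiv U)) y - F 2 y\<bar> \<le> M * (b - a)\<^sup>2 / 12"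
proof -
  define W :: "real poly" where "W = [:-a, 1:]\<^sup>2 * [:-b, 1:]\<^sup>2"
  define G where "G = (\<lambda>c j t. F j t - poly ((pderiv ^^ j) (U + smult c W)) t)"
  have G: "deriv_chain 4 (G c) {a..b}" for c
    unfolding G_def by (rule deriv_chain_diff_poly[OF F])
  have W: "poly W a = 0" "poly W b = 0" "poly (pderiv W) a = 0" "poly (pderiv W) b = 0"
      "poly W t = ((t - a) * (b - t))\<^sup>2" for t
    by (simp_all add: W_def power2_eq_square pderiv_mult pderiv_pCons algebra_simps)
  have W2: "poly (pderiv (pderiv W)) y = 2 * (b - a)\<^sup>2" if "y = a \<or> y = b" for y
    using that by (auto simp: W_def power2_eq_square pderiv_mult pderiv_pCons algebra_simps)
  have W4: "poly ((pderiv ^^ 4) W) t = 24" "poly ((pderiv ^^ 4) U) t = 0" for t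
  proof -
    have "degree W \<le> 4" "coeff W 4 = 1"
      by (simp_all add: W_def power2_eq_square numeral_eq_Suc degree_pCons_eq_if)
    then show "poly ((pderiv ^^ 4) W) t = 24"
      using poly_higher_pderiv_degree[of W 4 t] by (simp add: fact_numeral)
    have "coeff U 4 = 0" using U(1) by (simp add: coeff_eq_0)
    then show "poly ((pderiv ^^ 4) U) t = 0"
      using poly_higher_pderiv_degree[of U 4 t] U(1) by simp
  qed
  have ends: "G c 0 a = 0" "G c 0 b = 0" "G c (Suc 0) a = 0" "G c (Suc 0) b = 0" for c
    using U W by (simp_all add: G_def pderiv_add pderiv_smult)
  have bound: "\<bar>c\<bar> \<le> M / 24" if "z \<in> {a..b}" "G c 4 z = 0" for z c
  proof -
    have "F 4 z = c * 24"
      using that(2) W4 by (simp add: G_def higher_pderiv_add higher_pderiv_smult del: funpow.simps)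
    then show ?thesis using M[OF that(1)] by (auto simp: abs_mult)
  qed
  show "\<bar>poly U t - F 0 t\<bar> \<le> M * (b - a) ^ 4 / 384" if t: "t \<in> {a..b}"
  proof (cases "t = a \<or> t = b")
    case True
    moreover have "0 \<le> M" using M[of a] ab by simp
    ultimately show ?thesis using U by auto
  next
    case False
    with t have tt: "a < t" "t < b" by auto
    define c where "c = (F 0 t - poly U t) / poly W t"
    have Wt: "0 < poly W t" using tt by (simp add: W)
    have "G c 0 t = 0" using Wt by (simp add: G_def c_def)
    \<comment> \<open>Three zeros of the error leave two interior zeros of its derivative. With the
      end points these are four, enough for three more derivatives.\<close>
    have "\<And>z. z \<in> {a, t, b} \<Longrightarrow> G c 0 z = 0" "card {a, t, b} = Suc 2"
      using ends \<open>G c 0 t = 0\<close> tt by auto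
    then obtain Z1 where Z1: "finite Z1" "Z1 \<subseteq> {a..b}" "a \<notin> Z1" "b \<notin> Z1"
        "\<And>z. z \<in> Z1 \<Longrightarrow> G c (Suc 0) z = 0" "card Z1 = 2"
      by (rule Rolle_chain_step[OF G, rotated 3]) (use t ab in auto)
    then have "\<exists>z\<in>{a..b}. G c (Suc 0 + 3) z = 0"
      using ends ab by (intro Rolle_chain[OF G, where Z = "insert a (insert b Z1)"]) auto
    then obtain z where "z \<in> {a..b}" "G c 4 z = 0" by (auto simp: eval_nat_numeral)
    from bound[OF this] have c: "\<bar>c\<bar> \<le> M / 24" .
    have "(t - a) * (b - t) \<le> ((b - a) / 2)\<^sup>2"
      using zero_le_power2[of "(t - a) - (b - t)"] by (simp add: power2_eq_square field_simps)
    then have "((t - a) * (b - t))\<^sup>2 \<le> (((b - a) / 2)\<^sup>2)\<^sup>2"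
      using tt by (intro power_mono) auto
    then have "poly W t \<le> (b - a) ^ 4 / 16"
      by (simp add: W power_divide power_mult [symmetric])
    then have "\<bar>c\<bar> * poly W t \<le> M / 24 * ((b - a) ^ 4 / 16)"
      using c Wt by (intro mult_mono) auto
    moreover have "\<bar>poly U t - F 0 t\<bar> = \<bar>c\<bar> * poly W t"
      using Wt by (simp add: c_def abs_minus_commute)
    ultimately show ?thesis by simp
  qed
  show "\<bar>poly (pderiv (pderiv U)) y - F 2 y\<bar> \<le> M * (b - a)\<^sup>2 / 12" if y: "y = a \<or> y = b"
  proof -
    define c where "c = (F 2 y - poly (pderiv (pderiv U)) y) / (2 * (b - a)\<^sup>2)"
    have "G c 2 y = 0"
      using ab by (simp add: G_def c_def numeral_2_eq_2 pderiv_add pderiv_smult W2[OF y])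
    \<comment> \<open>Two zeros of the error leave one interior zero of its derivative, three with
      the end points; these leave two interior zeros of the second derivative, three with
      \<open>y\<close>.\<close>
    have "\<And>z. z \<in> {a, b} \<Longrightarrow> G c 0 z = 0" "card {a, b} = Suc 1"
      using ends ab by auto
    then obtain Z1 where Z1: "finite Z1" "Z1 \<subseteq> {a..b}" "a \<notin> Z1" "b \<notin> Z1"
        "\<And>z. z \<in> Z1 \<Longrightarrow> G c (Suc 0) z = 0" "card Z1 = 1"
      by (rule Rolle_chain_step[OF G, rotated 3]) (use ab in auto)
    have "\<And>z. z \<in> insert a (insert b Z1) \<Longrightarrow> G c (Suc 0) z = 0"
      "card (insert a (insert b Z1)) = Suc 2"
      using ends Z1 ab by auto
    then obtain Z2 where Z2: "finite Z2" "Z2 \<subseteq> {a..b}" "a \<notin> Z2" "b \<notin> Z2"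
        "\<And>z. z \<in> Z2 \<Longrightarrow> G c (Suc (Suc 0)) z = 0" "card Z2 = 2"
      by (rule Rolle_chain_step[OF G, rotated 3]) (use Z1 ab in auto)
    have "y \<notin> Z2" using y Z2(3,4) by auto
    then have "\<exists>z\<in>{a..b}. G c (Suc (Suc 0) + 2) z = 0"
      using Z2 \<open>G c 2 y = 0\<close> y ab
      by (intro Rolle_chain[OF G, where Z = "insert y Z2"]) (auto simp: numeral_2_eq_2)
    then obtain z where "z \<in> {a..b}" "G c 4 z = 0" by (auto simp: eval_nat_numeral)
    from bound[OF this] have "\<bar>c\<bar> * (2 * (b - a)\<^sup>2) \<le> M / 24 * (2 * (b - a)\<^sup>2)"
      by (intro mult_right_mono) auto
    moreover have "\<bar>poly (pderiv (pderiv U)) y - F 2 y\<bar> = \<bar>c\<bar> * (2 * (b - a)\<^sup>2)"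
      using ab by (simp add: c_def abs_minus_commute)
    ultimately show ?thesis by simp
  qed
qed

text \<open>\<open>P\<close> and the Hermite interpolant of \<open>F\<close> have the same end
  values, so their difference \<open>V\<close> is determined by the slope errors alone. All three
  bounds are \<open>hermite_remainder\<close> for \<open>P - V\<close>.\<close>

lemma cubic_remainder:
  fixes P :: "real poly"
  assumes F: "deriv_chain 4 F {a..b}" and ab: "a < b"
    and M: "\<And>t. t \<in> {a..b} \<Longrightarrow> \<bar>F 4 t\<bar> \<le> M"
    and P: "degree P \<le> 3" "poly P a = F 0 a" "poly P b = F 0 b"
    and e: "ea = poly (pderiv P) a - F 1 a" "eb = poly (pderiv P) b - F 1 b"
  shows cubic_remainder_value: "t \<in> {a..b} \<Longrightarrow>
      \<bar>poly P t - F 0 t - (ea * (t - a) * (b - t)\<^sup>2 - eb * (t - a)\<^sup>2 * (b - t)) / (b - a)\<^sup>2\<bar>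
        \<le> M * (b - a) ^ 4 / 384"
    and cubic_remainder_left:
      "\<bar>poly (pderiv (pderiv P)) a - F 2 a + 2 / (b - a) * (2 * ea + eb)\<bar> \<le> M * (b - a)\<^sup>2 / 12"
    and cubic_remainder_right:
      "\<bar>poly (pderiv (pderiv P)) b - 2 / (b - a) * (ea + 2 * eb) - F 2 b\<bar> \<le> M * (b - a)\<^sup>2 / 12"
proof -
  \<comment> \<open>Both vanish at the ends; divided by \<open>(b - a)\<^sup>2\<close> they have end
    slopes 1, 0 and 0, 1 respectively.\<close>
  define A B :: "real poly" where "A = [:-a, 1:] * [:-b, 1:]\<^sup>2" and "B = [:-a, 1:]\<^sup>2 * [:-b, 1:]"
  define V where "V = smult (ea / (b - a)\<^sup>2) A + smult (eb / (b - a)\<^sup>2) B"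
  have A: "poly A t = (t - a) * (b - t)\<^sup>2" "poly (pderiv A) a = (b - a)\<^sup>2" "poly (pderiv A) b = 0"
     "poly (pderiv (pderiv A)) a = - (4 * (b - a))" "poly (pderiv (pderiv A)) b = 2 * (b - a)" for t
    by (simp_all add: A_def power2_eq_square pderiv_mult pderiv_pCons algebra_simps)
  have B: "poly B t = - ((t - a)\<^sup>2 * (b - t))" "poly (pderiv B) a = 0" "poly (pderiv B) b = (b - a)\<^sup>2"
     "poly (pderiv (pderiv B)) a = - (2 * (b - a))" "poly (pderiv (pderiv B)) b = 4 * (b - a)" for t
    by (simp_all add: B_def power2_eq_square pderiv_mult pderiv_pCons algebra_simps)
  have "degree A \<le> 3" "degree B \<le> 3"
    by (simp_all add: A_def B_def power2_eq_square numeral_eq_Suc degree_pCons_eq_if)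
  then have "degree (P - V) \<le> 3"
    using P(1) unfolding V_def
    by (intro degree_diff_le degree_add_le order.trans[OF degree_smult_le]) auto
  note H = hermite_remainder[OF F ab M this]
  have ab0: "b - a \<noteq> 0" using ab by simp
  have V: "poly V a = 0" "poly V b = 0" "poly (pderiv V) a = ea" "poly (pderiv V) b = eb"
    "poly (pderiv (pderiv V)) a = - (2 / (b - a) * (2 * ea + eb))"
    "poly (pderiv (pderiv V)) b = 2 / (b - a) * (ea + 2 * eb)"
    using ab0 by (simp_all add: V_def A B pderiv_add pderiv_smult divide_simps)
      (simp_all add: power2_eq_square algebra_simps)
  have Vt: "poly V t = (ea * (t - a) * (b - t)\<^sup>2 - eb * (t - a)\<^sup>2 * (b - t)) / (b - a)\<^sup>2" for t
    by (simp add: V_def A B diff_divide_distrib)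
  show "\<bar>poly P t - F 0 t - (ea * (t - a) * (b - t)\<^sup>2 - eb * (t - a)\<^sup>2 * (b - t)) / (b - a)\<^sup>2\<bar>
        \<le> M * (b - a) ^ 4 / 384" if "t \<in> {a..b}"
    using H(1)[of t] that P e V unfolding Vt[symmetric] by (simp add: pderiv_diff algebra_simps)
  show "\<bar>poly (pderiv (pderiv P)) a - F 2 a + 2 / (b - a) * (2 * ea + eb)\<bar> \<le> M * (b - a)\<^sup>2 / 12"
    using H(2)[of a] P e V(1-4) by (simp add: pderiv_diff V(5) add_diff_eq diff_add_eq)
  show "\<bar>poly (pderiv (pderiv P)) b - 2 / (b - a) * (ea + 2 * eb) - F 2 b\<bar> \<le> M * (b - a)\<^sup>2 / 12"
    using H(2)[of b] P e V(1-4) by (simp add: pderiv_diff V(6))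
qed


text \<open>The sign \<open>\<sigma>\<close> treats the left and the right end at once. The bound by
  the fifth derivative uses the remainder formula at all five nodes, the one by the fourth only at
  the four nodes nearest to \<open>y\<close>; there the constant fourth derivative of
  \<open>P\<close> survives, but it is itself a value of \<open>F 4\<close>, which costs a factor
  2.\<close>

lemma end_deriv2_error:
  fixes P :: "real poly" and r :: "nat \<Rightarrow> real"
  assumes F: "deriv_chain 4 F {a..b}" and ab: "a \<le> b" and y: "y = a \<or> y = b"
    and \<sigma>: "\<sigma> = 1 \<or> \<sigma> = -1"
    and r: "r 0 = 0" "\<And>i. i < 4 \<Longrightarrow> r i < r (Suc i)" "\<And>i. i < 4 \<Longrightarrow> r (Suc i) \<le> r i + h"
    and mem: "\<And>i. i \<le> 4 \<Longrightarrow> y + \<sigma> * r i \<in> {a..b}"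
    and P: "degree P \<le> 4" "\<And>i. i \<le> 4 \<Longrightarrow> F 0 (y + \<sigma> * r i) = poly P (y + \<sigma> * r i)"
  shows end_deriv2_error_4: "(\<And>t. t \<in> {a..b} \<Longrightarrow> \<bar>F 4 t\<bar> \<le> M) \<Longrightarrow>
      \<bar>poly (pderiv (pderiv P)) y - F 2 y\<bar> \<le> 11 / 6 * M * h\<^sup>2"
    and end_deriv2_error_5: "deriv_chain 5 F {a..b} \<Longrightarrow> (\<And>t. t \<in> {a..b} \<Longrightarrow> \<bar>F 5 t\<bar> \<le> N) \<Longrightarrow>
      \<bar>poly (pderiv (pderiv P)) y - F 2 y\<bar> \<le> 5 / 6 * N * h ^ 3"
proof -
  define r1 r2 r3 r4 where "r1 = r 1" and "r2 = r 2" and "r3 = r 3" and "r4 = r 4"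
  note rs = r1_def r2_def r3_def r4_def
  have ord: "0 < r1" "r1 < r2" "r2 < r3" "r3 < r4"
    using r(1) r(2)[of 0] r(2)[of 1] r(2)[of 2] r(2)[of 3] by (simp_all add: rs eval_nat_numeral)
  have up: "r1 \<le> h" "r2 \<le> 2 * h" "r3 \<le> 3 * h" "r4 \<le> 4 * h"
    using r(1) r(3)[of 0] r(3)[of 1] r(3)[of 2] r(3)[of 3] by (simp_all add: rs eval_nat_numeral)
  have h: "0 < h" using ord up by simp
  define Y4 where "Y4 = {y, y + \<sigma> * r1, y + \<sigma> * r2, y + \<sigma> * r3}"
  define Y5 where "Y5 = insert (y + \<sigma> * r4) Y4"
  have Y: "finite Y4" "finite Y5" "card Y4 = 4" "card Y5 = 5"
    using ord \<sigma> by (auto simp: Y4_def Y5_def)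
  have mem5: "Y5 \<subseteq> {a..b}"
    using mem[of 0] mem[of 1] mem[of 2] mem[of 3] mem[of 4] r(1)
    by (simp add: Y4_def Y5_def rs)
  then have mem4: "Y4 \<subseteq> {a..b}" by (auto simp: Y5_def)
  have int5: "F 0 z = poly P z" if "z \<in> Y5" for z
    using that P(2)[of 0] P(2)[of 1] P(2)[of 2] P(2)[of 3] P(2)[of 4] r(1)
    by (auto simp: Y4_def Y5_def rs)
  then have int4: "F 0 z = poly P z" if "z \<in> Y4" for z
    using that by (simp add: Y5_def)
  define W4 where "W4 = [:-y, 1:] * ([:-(y + \<sigma> * r1), 1:] * ([:-(y + \<sigma> * r2), 1:] * [:-(y + \<sigma> * r3), 1:]))"
  define W5 where "W5 = [:-(y + \<sigma> * r4), 1:] * W4"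
  have W: "degree W4 \<le> 4" "coeff W4 4 = 1" "degree W5 \<le> 5" "coeff W5 5 = 1"
    by (simp_all add: W4_def W5_def numeral_eq_Suc degree_pCons_eq_if)
  have W0: "z \<in> Y4 \<Longrightarrow> poly W4 z = 0" "z \<in> Y5 \<Longrightarrow> poly W5 z = 0" for z
    by (auto simp: W4_def W5_def Y4_def Y5_def simp del: mult_pCons_left mult_pCons_right)
  define c4 where "c4 = 2 * (r1 * r2 + r1 * r3 + r2 * r3)"
  define c5 where "c5 = 2 * (r1 * r2 * r3 + r1 * r2 * r4 + r1 * r3 * r4 + r2 * r3 * r4)"
  \<comment> \<open>Writing the nodal polynomial as \<open>(X - y) * Q\<close>, its second
    derivative at \<open>y\<close> is \<open>2 * Q'(y)\<close>: twice a sum of products of two or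
    three signed distances. Three factors leave the sign \<open>- \<sigma>\<close>.\<close>
  have W2: "poly (pderiv (pderiv W4)) y = c4" "poly (pderiv (pderiv W5)) y = - \<sigma> * c5"
  proof -
    have lin: "pderiv [:- u, 1:] = [:1:]" for u :: real by (simp add: pderiv_pCons)
    have dd: "poly (pderiv (pderiv ([:-y, 1:] * Q))) y = 2 * poly (pderiv Q) y" for Q
      by (simp only: pderiv_mult pderiv_add poly_add poly_mult lin) simp
    have d: "poly (pderiv ([:-(y + u), 1:] * Q)) y = - u * poly (pderiv Q) y + poly Q y" for Q u
      by (simp only: pderiv_mult poly_add poly_mult lin) simp
    show "poly (pderiv (pderiv W4)) y = c4"
      using \<sigma> unfolding W4_def dd d lin poly_mult
      by (auto simp: c4_def algebra_simps)
    have W5: "W5 = [:-y, 1:] * ([:-(y + \<sigma> * r4), 1:] * ([:-(y + \<sigma> * r1), 1:] *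
        ([:-(y + \<sigma> * r2), 1:] * [:-(y + \<sigma> * r3), 1:])))"
      by (simp only: W5_def W4_def mult.left_commute)
    show "poly (pderiv (pderiv W5)) y = - \<sigma> * c5"
      using \<sigma> unfolding W5 dd d lin poly_mult
      by (auto simp: c5_def algebra_simps)
  qed
  have c: "0 < c4" "0 < c5" using ord by (auto simp: c4_def c5_def intro!: add_pos_pos)
  \<comment> \<open>Equal spacing \<open>h\<close> is the worst case: \<open>22\<close> and
    \<open>100\<close> are \<open>c4\<close> and \<open>c5\<close> for distances 1, 2, 3, 4. They
    yield \<open>22 * 2 / 24 = 11 / 6\<close> and \<open>100 / 120 = 5 / 6\<close>.\<close>
  have "r1 * r2 \<le> h * (2 * h)" "r1 * r3 \<le> h * (3 * h)" "r2 * r3 \<le> (2 * h) * (3 * h)"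
    using ord up by (intro mult_mono; simp)+
  then have c4: "c4 \<le> 22 * h\<^sup>2" by (simp add: c4_def power2_eq_square)
  have "r1 * r2 * r3 \<le> h * (2 * h) * (3 * h)" "r1 * r2 * r4 \<le> h * (2 * h) * (4 * h)"
    "r1 * r3 * r4 \<le> h * (3 * h) * (4 * h)" "r2 * r3 * r4 \<le> (2 * h) * (3 * h) * (4 * h)"
    using ord up h by (intro mult_mono; simp)+
  then have c5: "c5 \<le> 100 * h ^ 3" by (simp add: c5_def power3_eq_cube)
  show "\<bar>poly (pderiv (pderiv P)) y - F 2 y\<bar> \<le> 11 / 6 * M * h\<^sup>2"
    if M: "\<And>t. t \<in> {a..b} \<Longrightarrow> \<bar>F 4 t\<bar> \<le> M"
  proof -
    have "\<exists>z\<in>{a..b}. fact 4 * (F 2 y - poly (pderiv (pderiv P)) y) =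
      poly (pderiv (pderiv W4)) y * (F 4 z - poly ((pderiv ^^ 4) P) z)"
      using F Y mem4 int4 W0 W W2 c y ab by (intro interpolation_deriv2_remainder) auto
    then obtain z where z: "z \<in> {a..b}"
      "24 * (F 2 y - poly (pderiv (pderiv P)) y) = c4 * (F 4 z - poly ((pderiv ^^ 4) P) z)"
      by (auto simp: W2 fact_numeral)
    \<comment> \<open>The five zeros of the error of \<open>P\<close> give a point \<open>w\<close>
      where \<open>F 4\<close> equals the constant fourth derivative of \<open>P\<close>.\<close>
    define G where "G = (\<lambda>j t. F j t - poly ((pderiv ^^ j) P) t)"
    have "\<exists>z\<in>{a..b}. G (0 + 4) z = 0"
      using Y mem5 int5 unfolding G_def
      by (intro Rolle_chain[OF deriv_chain_diff_poly[OF F], of 0 4 Y5]) auto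
    then obtain w where w: "w \<in> {a..b}" "F 4 w = poly ((pderiv ^^ 4) P) w"
      by (auto simp: G_def)
    have "poly ((pderiv ^^ 4) P) w = poly ((pderiv ^^ 4) P) z"
      using P(1) by (simp only: poly_higher_pderiv_degree)
    then have "\<bar>F 4 z - poly ((pderiv ^^ 4) P) z\<bar> \<le> 2 * M"
      using M[OF z(1)] M[OF w(1)] w(2) by linarith
    then have "c4 * \<bar>F 4 z - poly ((pderiv ^^ 4) P) z\<bar> \<le> 22 * h\<^sup>2 * (2 * M)"
      using c4 c by (intro mult_mono) auto
    moreover have "24 * \<bar>F 2 y - poly (pderiv (pderiv P)) y\<bar> = c4 * \<bar>F 4 z - poly ((pderiv ^^ 4) P) z\<bar>"
      using arg_cong[OF z(2), of abs] c(1) unfolding abs_mult by simp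
    ultimately show ?thesis by (subst abs_minus_commute) (simp add: mult_ac)
  qed
  show "\<bar>poly (pderiv (pderiv P)) y - F 2 y\<bar> \<le> 5 / 6 * N * h ^ 3"
    if F5: "deriv_chain 5 F {a..b}" and N: "\<And>t. t \<in> {a..b} \<Longrightarrow> \<bar>F 5 t\<bar> \<le> N"
  proof -
    have "\<exists>z\<in>{a..b}. fact 5 * (F 2 y - poly (pderiv (pderiv P)) y) =
      poly (pderiv (pderiv W5)) y * (F 5 z - poly ((pderiv ^^ 5) P) z)"
      using F5 Y mem5 int5 W0 W W2 c y ab \<sigma> by (intro interpolation_deriv2_remainder) auto
    moreover have "poly ((pderiv ^^ 5) P) z = 0" for z
      using P(1) poly_higher_pderiv_degree[of P 5 z] by (simp add: coeff_eq_0 del: funpow.simps)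
    ultimately obtain z where z: "z \<in> {a..b}"
      "120 * (F 2 y - poly (pderiv (pderiv P)) y) = - \<sigma> * c5 * F 5 z"
      by (auto simp: W2 fact_numeral)
    have "c5 * \<bar>F 5 z\<bar> \<le> 100 * h ^ 3 * N"
      using c5 c N[OF z(1)] h by (intro mult_mono) auto
    moreover have "120 * \<bar>F 2 y - poly (pderiv (pderiv P)) y\<bar> = c5 * \<bar>F 5 z\<bar>"
      using arg_cong[OF z(2), of abs] c(2) \<sigma> unfolding abs_mult by auto
    ultimately show ?thesis by (subst abs_minus_commute) (simp add: mult_ac)
  qed
qed

section \<open>Null splines\<close>

text \<open>The second derivatives of a spline vanishing at all knots alternate in sign;
  \<open>a i\<close> is their modulus for the one with second derivative \<open>1\<close> at the first
  and \<open>0\<close> at the last knot, where \<open>k i\<close> is the length of the \<open>i\<close>-th cell.\<close>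

definition null_weights :: "nat \<Rightarrow> (nat \<Rightarrow> real) \<Rightarrow> (nat \<Rightarrow> real) \<Rightarrow> bool" where
  "null_weights n k a \<longleftrightarrow> a 0 = 1 \<and> a n = 0 \<and>
     (\<forall>i<n. 0 \<le> a i \<and> 2 * a (Suc i) \<le> a i) \<and>
     (\<forall>i. Suc i < n \<longrightarrow>
        k i * a i - 2 * (k i + k (Suc i)) * a (Suc i) + k (Suc i) * a (Suc (Suc i)) = 0)"

lemma null_weights_rec:
  assumes "null_weights n k a" "Suc i < n"
  shows "k i * a i - 2 * (k i + k (Suc i)) * a (Suc i) + k (Suc i) * a (Suc (Suc i)) = 0"
  using assms unfolding null_weights_def by blast

lemma null_weights_half:
  assumes "null_weights n k a" "i < n"
  shows "2 * a (Suc i) \<le> a i"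
  using assms unfolding null_weights_def by blast

text \<open>The induction adds a cell in front and scales the old weights by \<open>c\<close>. The
  equation at the new first interior knot forces \<open>c * q = k 0\<close>; since the old
  \<open>a 1\<close> is at most \<open>1/2\<close>, \<open>q\<close> is at least
  \<open>2 * k 0\<close>, so the weights again halve at the first step.\<close>

lemma null_weights_exist:
  assumes "1 \<le> n" "\<And>i. i < n \<Longrightarrow> 0 < k i"
  shows "\<exists>a. null_weights n k a"
  using assms
proof (induction n arbitrary: k rule: nat_induct_at_least)
  case base
  show ?case
    by (intro exI[of _ "\<lambda>i. if i = 0 then 1 else 0"]) (simp add: null_weights_def)
next
  case (Suc n)
  from Suc.IH[of "\<lambda>i. k (Suc i)"] Suc.prems
  obtain a where a: "null_weights n (\<lambda>i. k (Suc i)) a" by auto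
  have a1: "2 * a 1 \<le> 1"
    using null_weights_half[OF a, of 0] a Suc.hyps by (simp add: null_weights_def)
  have k: "0 < k 0" "0 < k 1" using Suc.prems Suc.hyps by auto
  define q where "q = 2 * (k 0 + k 1) - k 1 * a 1"
  have "k 1 * a 1 \<le> k 1 * 1" using k a1 by (intro mult_left_mono) auto
  then have q: "2 * k 0 \<le> q" "0 < q" using k unfolding q_def distrib_left by linarith+
  define c where "c = k 0 / q"
  have c: "0 \<le> c" "2 * c \<le> 1" "c * q = k 0" using q k by (auto simp: c_def)
  define a' where "a' = (\<lambda>i. case i of 0 \<Rightarrow> 1 | Suc j \<Rightarrow> c * a j)"
  have a'[simp]: "a' 0 = 1" "a' (Suc j) = c * a j" for j by (auto simp: a'_def)
  have "0 \<le> a' i \<and> 2 * a' (Suc i) \<le> a' i" if "i < Suc n" for i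
  proof (cases i)
    case 0
    then show ?thesis using c a by (simp add: null_weights_def)
  next
    case (Suc j)
    then have "0 \<le> a j" "2 * a (Suc j) \<le> a j" using a that by (auto simp: null_weights_def)
    then show ?thesis using Suc c mult_left_mono[of "2 * a (Suc j)" "a j" c]
      by (auto simp: algebra_simps)
  qed
  moreover have "k i * a' i - 2 * (k i + k (Suc i)) * a' (Suc i) + k (Suc i) * a' (Suc (Suc i)) = 0"
    if "Suc i < Suc n" for i
  proof (cases i)
    case 0
    then show ?thesis using c(3) a by (simp add: null_weights_def q_def algebra_simps)
  next
    case (Suc j)
    then have "k i * a j - 2 * (k i + k (Suc i)) * a i + k (Suc i) * a (Suc i) = 0"
      using null_weights_rec[OF a, of j] that by simp
    then have "c * (k i * a j - 2 * (k i + k (Suc i)) * a i + k (Suc i) * a (Suc i)) = 0" by simp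
    then show ?thesis using Suc by (simp add: algebra_simps)
  qed
  moreover have "a' (Suc n) = 0" using a by (simp add: null_weights_def)
  ultimately show ?case unfolding null_weights_def using a'(1) by blast
qed

lemma null_weights_bounds:
  assumes "null_weights n k a" "i \<le> n"
  shows "0 \<le> a i" "a i \<le> (1 / 2) ^ i"
proof -
  show "0 \<le> a i" using assms by (cases "i = n") (auto simp: null_weights_def)
  show "a i \<le> (1 / 2) ^ i" using assms(2)
  proof (induction i)
    case (Suc i)
    then have "2 * a (Suc i) \<le> a i" using assms(1) by (simp add: null_weights_def)
    then show ?case using Suc by simp
  qed (use assms in \<open>simp add: null_weights_def\<close>)
qed

text \<open>Up to the factor \<open>1/6\<close> this bounds a null spline on an end cell when its
  end second derivatives have modulus 1: \<open>a\<close> is the weight at the inner knot of the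
  cell, \<open>b\<close> the contribution from the far end. Without the subtracted term,
  \<open>3/8\<close> would be exceeded for \<open>k = h\<close> even if \<open>b = 0\<close>. The
  lower bound on \<open>a\<close> is weak for short cells, but there \<open>k\<^sup>2\<close>
  compensates.\<close>

lemma end_cell_bound:
  fixes k h \<tau> a b :: real
  assumes k: "0 < k" "k \<le> h" and \<tau>: "0 \<le> \<tau>" "\<tau> \<le> 1" and a: "k / (4 * h) \<le> a" and b: "b \<le> 1 / 8"
  shows "k\<^sup>2 * (\<tau> * (1 - \<tau>)) * ((2 - \<tau>) - a * (1 + \<tau>) + b * (1 + \<tau>)) \<le> 3 / 8 * h\<^sup>2"
proof -
  define u where "u = k / h"
  have u: "0 < u" "u \<le> 1" "k = u * h" using k by (auto simp: u_def)
  define C E where "C = (2 - \<tau>) + (1 + \<tau>) / 8" and "E = (1 + \<tau>) / 4"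
  have "u / 4 * (1 + \<tau>) \<le> a * (1 + \<tau>)" "b * (1 + \<tau>) \<le> 1 / 8 * (1 + \<tau>)"
    using a b \<tau> by (intro mult_right_mono; simp add: u_def)+
  then have 1: "(2 - \<tau>) - a * (1 + \<tau>) + b * (1 + \<tau>) \<le> C - u * E"
    by (simp add: C_def E_def) (simp add: field_simps)
  \<comment> \<open>Preparation for \<open>2\<close>, which says that
    \<open>u\<^sup>2 * (C - u * E)\<close> is largest at \<open>u = 1\<close>, that is, for a cell
    of full length \<open>h\<close>.\<close>
  have "1 - u ^ 3 \<le> (1 - u\<^sup>2) * (3 / 2)"
  proof -
    have "(1 - u\<^sup>2) * (3 / 2) - (1 - u ^ 3) = (1 - u) * ((1 - u) * (1 / 2 + u))"
      by (simp add: power2_eq_square power3_eq_cube field_simps)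
    moreover have "0 \<le> (1 - u) * ((1 - u) * (1 / 2 + u))" using u by (intro mult_nonneg_nonneg) auto
    ultimately have "0 \<le> (1 - u\<^sup>2) * (3 / 2) - (1 - u ^ 3)" by (simp only:)
    then show ?thesis by simp
  qed
  then have "(1 - u ^ 3) * E \<le> (1 - u\<^sup>2) * (3 / 2) * E"
    using \<tau> by (intro mult_right_mono) (auto simp: E_def)
  also have "\<dots> \<le> (1 - u\<^sup>2) * C"
  proof -
    have "u\<^sup>2 \<le> 1" "3 / 2 * E \<le> C" using \<tau> u by (auto simp: E_def C_def power_le_one field_simps)
    then show ?thesis unfolding mult.assoc by (intro mult_left_mono) auto
  qed
  finally have 2: "u\<^sup>2 * (C - u * E) \<le> C - E"
    by (simp add: power2_eq_square power3_eq_cube algebra_simps)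
  \<comment> \<open>Since \<open>C - E = 3 * (5 - 3 * \<tau>) / 8\<close>, the claim
    \<open>3\<close> amounts to \<open>\<tau> * (1 - \<tau>) * (5 - 3 * \<tau>) \<le> 1\<close>, and
    the expression here is the difference of the two sides.\<close>
  have "0 \<le> (1 - \<tau>) * (1 - 2 * \<tau>)\<^sup>2 + \<tau> ^ 3" using \<tau> by simp
  then have 3: "\<tau> * (1 - \<tau>) * (C - E) \<le> 3 / 8"
    by (simp add: C_def E_def power2_eq_square power3_eq_cube field_simps)
  have "k\<^sup>2 * (\<tau> * (1 - \<tau>)) * ((2 - \<tau>) - a * (1 + \<tau>) + b * (1 + \<tau>))
      \<le> k\<^sup>2 * (\<tau> * (1 - \<tau>)) * (C - u * E)"
    using 1 \<tau> by (intro mult_left_mono) auto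
  also have "\<dots> = h\<^sup>2 * (\<tau> * (1 - \<tau>)) * (u\<^sup>2 * (C - u * E))"
    by (simp add: u(3) power_mult_distrib)
  also have "\<dots> \<le> h\<^sup>2 * (\<tau> * (1 - \<tau>)) * (C - E)"
    using 2 \<tau> by (intro mult_left_mono) auto
  also have "\<dots> \<le> h\<^sup>2 * (3 / 8)"
    using 3 by (simp only: mult.assoc) (intro mult_left_mono, auto)
  finally show ?thesis by simp
qed

text \<open>The equation at the first interior knot and \<open>a 2 \<ge> 0\<close> give
  \<open>a 1 \<ge> k 0 / (4 * h)\<close>; as \<open>n \<ge> 4\<close>, the weight from the far end
  has halved at least three times.\<close>

lemma null_weights_end_cell:
  fixes k a b :: "nat \<Rightarrow> real"
  assumes a: "null_weights n k a" and b: "null_weights n k' b" and n: "4 \<le> n"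
    and k: "\<And>i. i < n \<Longrightarrow> 0 < k i" "\<And>i. i < n \<Longrightarrow> k i \<le> h"
    and \<tau>: "0 \<le> \<tau>" "\<tau> \<le> 1"
  shows "(k 0)\<^sup>2 * (\<tau> * (1 - \<tau>)) * (a 0 * (2 - \<tau>) - a 1 * (1 + \<tau>) + b (n - 1) * (1 + \<tau>))
    \<le> 3 / 8 * h\<^sup>2"
proof -
  have k01: "0 < k 0" "0 < k 1" "k 0 \<le> h" "k 1 \<le> h" using k n by auto
  have "k 0 * a 0 - 2 * (k 0 + k 1) * a 1 + k 1 * a 2 = 0"
    using null_weights_rec[OF a, of 0] n by (simp add: numeral_2_eq_2)
  moreover have "0 \<le> k 1 * a 2" using null_weights_bounds(1)[OF a, of 2] n k01 by simp
  ultimately have "k 0 \<le> a 1 * (2 * (k 0 + k 1))"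
    using a by (simp add: null_weights_def algebra_simps)
  also have "\<dots> \<le> a 1 * (4 * h)"
    using null_weights_bounds(1)[OF a, of 1] n k01 by (intro mult_left_mono) auto
  finally have "k 0 / (4 * h) \<le> a 1" using k01 by (simp add: field_simps)
  moreover have "b (n - 1) \<le> 1 / 8"
  proof -
    have "b (n - 1) \<le> (1 / 2) ^ (n - 1)" using null_weights_bounds(2)[OF b] by simp
    also have "\<dots> \<le> (1 / 2) ^ 3" using n by (intro power_decreasing) auto
    finally show ?thesis by (simp add: power3_eq_cube)
  qed
  ultimately show ?thesis
    using end_cell_bound[of "k 0" h \<tau> "a 1" "b (n - 1)"] a k01 \<tau> by (simp add: null_weights_def)
qed

text \<open>On an inner cell both leading weights have halved at least once, so the bracket is at
  most \<open>(2 - \<tau>) / 2 + (1 + \<tau>) / 2 = 3 / 2\<close>, and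
  \<open>\<tau> * (1 - \<tau>) \<le> 1/4\<close> suffices. Only the end cells, where one weight is
  1, need the finer estimate.\<close>

lemma null_weights_cell:
  fixes k a b :: "nat \<Rightarrow> real"
  assumes a: "null_weights n k a" and b: "null_weights n (\<lambda>i. k (n - Suc i)) b" and n: "4 \<le> n"
    and k: "\<And>i. i < n \<Longrightarrow> 0 < k i" "\<And>i. i < n \<Longrightarrow> k i \<le> h"
    and \<tau>: "0 \<le> \<tau>" "\<tau> \<le> 1" and i: "i < n"
  shows "(k i)\<^sup>2 * (\<tau> * (1 - \<tau>)) *
      (a i * (2 - \<tau>) - a (Suc i) * (1 + \<tau>) + (b (n - Suc i) * (1 + \<tau>) - b (n - i) * (2 - \<tau>)))
    \<le> 3 / 8 * h\<^sup>2"
proof -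
  let ?T = "a i * (2 - \<tau>) - a (Suc i) * (1 + \<tau>) + (b (n - Suc i) * (1 + \<tau>) - b (n - i) * (2 - \<tau>))"
  have pos: "0 \<le> (k i)\<^sup>2 * (\<tau> * (1 - \<tau>))" using \<tau> by simp
  have ends: "0 \<le> a (Suc i) * (1 + \<tau>)" "0 \<le> b (n - i) * (2 - \<tau>)"
    using null_weights_bounds(1)[OF a, of "Suc i"] null_weights_bounds(1)[OF b, of "n - i"] i \<tau> by auto
  consider "i = 0" | "Suc i = n" | "0 < i" "Suc i < n" using i by linarith
  then show ?thesis
  proof cases
    case 1
    have "?T \<le> a 0 * (2 - \<tau>) - a 1 * (1 + \<tau>) + b (n - 1) * (1 + \<tau>)" using ends 1 by simp
    from mult_left_mono[OF this pos] null_weights_end_cell[OF a b n k \<tau>] 1 show ?thesis by simp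
  next
    case 2
    then have eqs: "n - 1 = i" "n - Suc 0 = i" "n - i = 1" "n - Suc i = 0" "a (Suc i) = 0"
      using a by (auto simp: null_weights_def)
    \<comment> \<open>Reflection of the knots: \<open>a\<close> and \<open>b\<close> change places
      and \<open>\<tau>\<close> becomes \<open>1 - \<tau>\<close>.\<close>
    have "(k (n - Suc 0))\<^sup>2 * ((1 - \<tau>) * (1 - (1 - \<tau>))) *
        (b 0 * (2 - (1 - \<tau>)) - b 1 * (1 + (1 - \<tau>)) + a (n - 1) * (1 + (1 - \<tau>))) \<le> 3 / 8 * h\<^sup>2"
      by (rule null_weights_end_cell[OF b a n]) (use k \<tau> in auto)
    moreover have "?T = b 0 * (2 - (1 - \<tau>)) - b 1 * (1 + (1 - \<tau>)) + a (n - 1) * (1 + (1 - \<tau>))"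
      unfolding eqs by (simp add: algebra_simps)
    moreover have "\<tau> * (1 - \<tau>) = (1 - \<tau>) * (1 - (1 - \<tau>))" by simp
    ultimately show ?thesis unfolding eqs(2) by (simp only:)
  next
    case 3
    have "a i \<le> (1 / 2) ^ i" "b (n - Suc i) \<le> (1 / 2) ^ (n - Suc i)"
      using null_weights_bounds(2)[OF a, of i] null_weights_bounds(2)[OF b, of "n - Suc i"] i by auto
    moreover have "(1 / 2 :: real) ^ i \<le> (1 / 2) ^ 1" "(1 / 2 :: real) ^ (n - Suc i) \<le> (1 / 2) ^ 1"
      using 3 by (intro power_decreasing; simp)+
    ultimately have "a i \<le> 1 / 2" "b (n - Suc i) \<le> 1 / 2" by auto
    then have "a i * (2 - \<tau>) \<le> 1 / 2 * (2 - \<tau>)" "b (n - Suc i) * (1 + \<tau>) \<le> 1 / 2 * (1 + \<tau>)"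
      using \<tau> by (intro mult_right_mono; simp)+
    then have "?T \<le> 3 / 2" using ends by simp
    moreover have "(k i)\<^sup>2 * (\<tau> * (1 - \<tau>)) \<le> h\<^sup>2 * (1 / 4)"
    proof (intro mult_mono power_mono)
      show "\<tau> * (1 - \<tau>) \<le> 1 / 4"
        using zero_le_power2[of "1 - 2 * \<tau>"] by (simp add: power2_eq_square algebra_simps)
    qed (use k[OF i] \<tau> in auto)
    ultimately have "(k i)\<^sup>2 * (\<tau> * (1 - \<tau>)) * (3 / 2) \<le> 3 / 8 * h\<^sup>2"
      "(k i)\<^sup>2 * (\<tau> * (1 - \<tau>)) * ?T \<le> (k i)\<^sup>2 * (\<tau> * (1 - \<tau>)) * (3 / 2)"
      using mult_left_mono[OF _ pos, of ?T "3 / 2"] by linarith+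
    then show ?thesis by linarith
  qed
qed

text \<open>\<open>\<delta> i\<close> is the second derivative at knot \<open>i\<close>, and the
  recurrence is continuity of the slope when all knot values vanish. The spline on cell
  \<open>i\<close> is \<open>- (k i)\<^sup>2 / 6 * \<tau> * (1 - \<tau>)\<close> times the
  expression inside the modulus, so the last clause bounds it by \<open>D * h\<^sup>2 / 16\<close>.
  The solution superposes alternating weights from both ends.\<close>

lemma null_spline_exists:
  fixes k :: "nat \<Rightarrow> real" and h D dl dr :: real
  assumes n: "4 \<le> n" and k: "\<And>i. i < n \<Longrightarrow> 0 < k i" "\<And>i. i < n \<Longrightarrow> k i \<le> h"
    and d: "\<bar>dl\<bar> \<le> D" "\<bar>dr\<bar> \<le> D"
  shows "\<exists>\<delta>. \<delta> 0 = dl \<and> \<delta> n = dr \<and>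
    (\<forall>i. Suc i < n \<longrightarrow>
      k i * \<delta> i + 2 * (k i + k (Suc i)) * \<delta> (Suc i) + k (Suc i) * \<delta> (Suc (Suc i)) = 0) \<and>
    (\<forall>i<n. \<forall>\<tau>\<in>{0..1}.
      (k i)\<^sup>2 * (\<tau> * (1 - \<tau>)) * \<bar>\<delta> i * (2 - \<tau>) + \<delta> (Suc i) * (1 + \<tau>)\<bar> \<le> 3 / 8 * D * h\<^sup>2)"
proof -
  have n1: "1 \<le> n" using n by simp
  obtain a where a: "null_weights n k a" using null_weights_exist[of n k] n1 k(1) by blast
  have "\<exists>b. null_weights n (\<lambda>i. k (n - Suc i)) b" using n1 k by (intro null_weights_exist) auto
  then obtain b where b: "null_weights n (\<lambda>i. k (n - Suc i)) b" by blast
  define \<delta> where "\<delta> = (\<lambda>i. dl * ((-1) ^ i * a i) + dr * ((-1) ^ (n - i) * b (n - i)))"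
  have "\<delta> 0 = dl" "\<delta> n = dr" using a b by (auto simp: \<delta>_def null_weights_def)
  moreover have "k i * \<delta> i + 2 * (k i + k (Suc i)) * \<delta> (Suc i) + k (Suc i) * \<delta> (Suc (Suc i)) = 0"
    if i: "Suc i < n" for i
  proof -
    define m where "m = n - Suc (Suc i)"
    have m: "n - i = Suc (Suc m)" "n - Suc i = Suc m" "n - Suc (Suc i) = m"
      "n - Suc m = Suc i" "n - Suc (Suc m) = i"
      using i by (auto simp: m_def)
    have A: "k i * a i - 2 * (k i + k (Suc i)) * a (Suc i) + k (Suc i) * a (Suc (Suc i)) = 0"
      using null_weights_rec[OF a i] .
    have "Suc m < n" using i by (auto simp: m_def)
    from null_weights_rec[OF b this] have "k (n - Suc m) * b m - 2 * (k (n - Suc m) + k (n - Suc (Suc m))) * b (Suc m)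
        + k (n - Suc (Suc m)) * b (Suc (Suc m)) = 0"
      .
    then have B: "k (Suc i) * b m - 2 * (k (Suc i) + k i) * b (Suc m) + k i * b (Suc (Suc m)) = 0"
      by (simp add: m)
    have "k i * \<delta> i + 2 * (k i + k (Suc i)) * \<delta> (Suc i) + k (Suc i) * \<delta> (Suc (Suc i)) =
       dl * (-1) ^ i * (k i * a i - 2 * (k i + k (Suc i)) * a (Suc i) + k (Suc i) * a (Suc (Suc i)))
     + dr * (-1) ^ m * (k (Suc i) * b m - 2 * (k (Suc i) + k i) * b (Suc m) + k i * b (Suc (Suc m)))"
      by (simp add: \<delta>_def m algebra_simps)
    then show ?thesis using A B by simp
  qed
  moreover have "(k i)\<^sup>2 * (\<tau> * (1 - \<tau>)) * \<bar>\<delta> i * (2 - \<tau>) + \<delta> (Suc i) * (1 + \<tau>)\<bar> \<le> 3 / 8 * D * h\<^sup>2"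
    if i: "i < n" and \<tau>: "\<tau> \<in> {0..1}" for i \<tau>
  proof -
    define A B where "A = a i * (2 - \<tau>) - a (Suc i) * (1 + \<tau>)"
      and "B = b (n - Suc i) * (1 + \<tau>) - b (n - i) * (2 - \<tau>)"
    have m: "n - i = Suc (n - Suc i)" using i by simp
    \<comment> \<open>Halving compensates for the factors, which may be as unfavourable as 1 and 2.
      So each end contributes with a single sign on a whole cell, and the triangle inequality leaves
      exactly the sum bounded in \<open>null_weights_cell\<close>.\<close>
    have *: "0 \<le> u * p - v * q" if "2 * v \<le> u" "0 \<le> v" "1 \<le> p" "0 \<le> q" "q \<le> 2" for u v p q :: real
    proof -
      have "v * q \<le> v * 2" "u * 1 \<le> u * p" using that by (intro mult_left_mono; simp)+
      then show ?thesis using that by simp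
    qed
    have "0 \<le> A" unfolding A_def
      using null_weights_bounds(1)[OF a, of "Suc i"] null_weights_half[OF a i] i \<tau> by (intro *) auto
    moreover have "0 \<le> B" unfolding B_def m
      using null_weights_bounds(1)[OF b, of "Suc (n - Suc i)"] null_weights_half[OF b, of "n - Suc i"] i \<tau>
      by (intro *) auto
    moreover have "\<delta> i * (2 - \<tau>) + \<delta> (Suc i) * (1 + \<tau>) =
        dl * (-1) ^ i * A + dr * (-1) ^ (n - Suc i) * B"
      by (simp add: \<delta>_def A_def B_def m algebra_simps)
    ultimately have "\<bar>\<delta> i * (2 - \<tau>) + \<delta> (Suc i) * (1 + \<tau>)\<bar> \<le> \<bar>dl\<bar> * A + \<bar>dr\<bar> * B"
      using abs_triangle_ineq[of "dl * (-1) ^ i * A" "dr * (-1) ^ (n - Suc i) * B"]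
      by (simp add: abs_mult power_abs)
    also have "\<dots> \<le> D * A + D * B"
      using d \<open>0 \<le> A\<close> \<open>0 \<le> B\<close> by (intro add_mono mult_right_mono)
    finally have "\<bar>\<delta> i * (2 - \<tau>) + \<delta> (Suc i) * (1 + \<tau>)\<bar> \<le> D * (A + B)" by (simp add: algebra_simps)
    moreover have "0 \<le> (k i)\<^sup>2 * (\<tau> * (1 - \<tau>))" using \<tau> by simp
    ultimately have "(k i)\<^sup>2 * (\<tau> * (1 - \<tau>)) * \<bar>\<delta> i * (2 - \<tau>) + \<delta> (Suc i) * (1 + \<tau>)\<bar>
       \<le> (k i)\<^sup>2 * (\<tau> * (1 - \<tau>)) * (D * (A + B))"
      by (intro mult_left_mono)
    also have "\<dots> = D * ((k i)\<^sup>2 * (\<tau> * (1 - \<tau>)) * (A + B))" by simp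
    also have "\<dots> \<le> D * (3 / 8 * h\<^sup>2)"
      using null_weights_cell[OF a b n k _ _ i, of \<tau>] \<tau> d(1) unfolding A_def B_def
      by (intro mult_left_mono) auto
    finally show ?thesis by simp
  qed
  ultimately show ?thesis by blast
qed

text \<open>The null spline in terms of its slopes, so that it can be subtracted from the slope
  errors. A cubic vanishing at both ends of a cell of length \<open>k\<close> with end slopes
  \<open>u\<close> and \<open>v\<close> has second derivatives \<open>- 2 / k * (2 * u + v)\<close>
  and \<open>2 / k * (u + 2 * v)\<close> there.\<close>

lemma null_spline_slopes_exist:
  fixes k :: "nat \<Rightarrow> real" and h D dl dr :: real
  assumes n: "4 \<le> n" and k: "\<And>i. i < n \<Longrightarrow> 0 < k i" "\<And>i. i < n \<Longrightarrow> k i \<le> h"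
    and d: "\<bar>dl\<bar> \<le> D" "\<bar>dr\<bar> \<le> D"
  obtains \<epsilon> where
    "2 / k 0 * (2 * \<epsilon> 0 + \<epsilon> (Suc 0)) = - dl"
    "2 / k (n - 1) * (\<epsilon> (n - 1) + 2 * \<epsilon> n) = dr"
    "\<And>i. Suc i < n \<Longrightarrow>
      2 / k i * (\<epsilon> i + 2 * \<epsilon> (Suc i)) + 2 / k (Suc i) * (2 * \<epsilon> (Suc i) + \<epsilon> (Suc (Suc i))) = 0"
    "\<And>i \<tau>. i < n \<Longrightarrow> \<tau> \<in> {0..1} \<Longrightarrow>
      \<bar>k i * (\<epsilon> i * (\<tau> * (1 - \<tau>)\<^sup>2) - \<epsilon> (Suc i) * (\<tau>\<^sup>2 * (1 - \<tau>)))\<bar> \<le> D * h\<^sup>2 / 16"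
proof -
  from null_spline_exists[where k = k, OF n k d] obtain \<delta> where \<delta>: "\<delta> 0 = dl" "\<delta> n = dr"
    "\<And>i. Suc i < n \<Longrightarrow>
      k i * \<delta> i + 2 * (k i + k (Suc i)) * \<delta> (Suc i) + k (Suc i) * \<delta> (Suc (Suc i)) = 0"
    "\<And>i \<tau>. i < n \<Longrightarrow> \<tau> \<in> {0..1} \<Longrightarrow>
      (k i)\<^sup>2 * (\<tau> * (1 - \<tau>)) * \<bar>\<delta> i * (2 - \<tau>) + \<delta> (Suc i) * (1 + \<tau>)\<bar> \<le> 3 / 8 * D * h\<^sup>2"
    by blast
  \<comment> \<open>Slopes are read off the cell to the right of a knot; the last knot has only a
    left cell.\<close>
  define \<epsilon> where "\<epsilon> = (\<lambda>i. if i < n then - (k i / 6 * (2 * \<delta> i + \<delta> (Suc i)))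
    else k (n - 1) / 6 * (\<delta> (n - 1) + 2 * \<delta> n))"
  have left: "\<epsilon> i = - (k i / 6 * (2 * \<delta> i + \<delta> (Suc i)))" if "i < n" for i
    using that by (simp add: \<epsilon>_def)
  \<comment> \<open>At an inner knot the recurrence for \<open>\<delta>\<close> says that the left
    cell gives the same slope.\<close>
  have right: "\<epsilon> (Suc i) = k i / 6 * (\<delta> i + 2 * \<delta> (Suc i))" if "i < n" for i
  proof (cases "Suc i < n")
    case True
    then show ?thesis using \<delta>(3)[OF True] by (simp add: \<epsilon>_def algebra_simps)
  next
    case False
    with that have "Suc i = n" by simp
    then show ?thesis by (auto simp: \<epsilon>_def)
  qed
  have l: "2 / k i * (2 * \<epsilon> i + \<epsilon> (Suc i)) = - \<delta> i"
    and r: "2 / k i * (\<epsilon> i + 2 * \<epsilon> (Suc i)) = \<delta> (Suc i)" if "i < n" for i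
    using k(1)[OF that] by (simp_all add: left[OF that] right[OF that] field_simps)
  have cell: "\<bar>k i * (\<epsilon> i * (\<tau> * (1 - \<tau>)\<^sup>2) - \<epsilon> (Suc i) * (\<tau>\<^sup>2 * (1 - \<tau>)))\<bar> \<le> D * h\<^sup>2 / 16"
    if "i < n" "\<tau> \<in> {0..1}" for i \<tau>
  proof -
    have "k i * (\<epsilon> i * (\<tau> * (1 - \<tau>)\<^sup>2) - \<epsilon> (Suc i) * (\<tau>\<^sup>2 * (1 - \<tau>))) =
      - ((k i)\<^sup>2 * (\<tau> * (1 - \<tau>)) * (\<delta> i * (2 - \<tau>) + \<delta> (Suc i) * (1 + \<tau>)) / 6)"
      by (simp add: left[OF that(1)] right[OF that(1)] power2_eq_square field_simps)
    then show ?thesis using \<delta>(4)[OF that] that(2) by (simp add: abs_mult mult_ac)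
  qed
  show ?thesis
  proof
    show "2 / k 0 * (2 * \<epsilon> 0 + \<epsilon> (Suc 0)) = - dl" using l[of 0] n \<delta>(1) by simp
    show "2 / k (n - 1) * (\<epsilon> (n - 1) + 2 * \<epsilon> n) = dr" using r[of "n - 1"] n \<delta>(2) by simp
    show "2 / k i * (\<epsilon> i + 2 * \<epsilon> (Suc i)) + 2 / k (Suc i) * (2 * \<epsilon> (Suc i) + \<epsilon> (Suc (Suc i))) = 0"
      if "Suc i < n" for i
      using r[of i] l[of "Suc i"] that by simp
  qed (fact cell)
qed

section \<open>The diagonally dominant system for the slopes\<close>

text \<open>Diagonal dominance: compare both sides at an entry of maximal modulus.\<close>

lemma slope_system_bound:
  fixes z k :: "nat \<Rightarrow> real"
  assumes k: "\<And>i. i < n \<Longrightarrow> 0 < k i" "\<And>i. i < n \<Longrightarrow> k i \<le> h" and n: "0 < n" and M: "0 \<le> M"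
    and l: "\<bar>2 / k 0 * (2 * z 0 + z (Suc 0))\<bar> \<le> M * (k 0)\<^sup>2 / 12"
    and r: "\<bar>2 / k (n - 1) * (z (n - 1) + 2 * z n)\<bar> \<le> M * (k (n - 1))\<^sup>2 / 12"
    and m: "\<And>i. Suc i < n \<Longrightarrow>
      \<bar>2 / k i * (z i + 2 * z (Suc i)) + 2 / k (Suc i) * (2 * z (Suc i) + z (Suc (Suc i)))\<bar>
        \<le> M * ((k i)\<^sup>2 + (k (Suc i))\<^sup>2) / 12"
    and i: "i \<le> n"
  shows "\<bar>z i\<bar> \<le> M * h ^ 3 / 24"
proof -
  define A where "A = Max ((\<lambda>i. \<bar>z i\<bar>) ` {..n})"
  have le: "\<bar>z i\<bar> \<le> A" if "i \<le> n" for i using that by (simp add: A_def)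
  have "A \<in> (\<lambda>i. \<bar>z i\<bar>) ` {..n}" unfolding A_def by (intro Max_in) auto
  then obtain j where j: "j \<le> n" "A = \<bar>z j\<bar>" by auto
  have end_bound: "A \<le> M * h ^ 3 / 24"
    if "\<bar>2 / p * w\<bar> \<le> M * p\<^sup>2 / 12" "A \<le> \<bar>w\<bar>" "0 < p" "p \<le> h" for p w
  proof -
    have "A \<le> M * p ^ 3 / 24"
      using that by (simp add: abs_mult field_simps power2_eq_square power3_eq_cube)
    also have "\<dots> \<le> M * h ^ 3 / 24"
      using that M by (intro divide_right_mono mult_left_mono power_mono) auto
    finally show ?thesis .
  qed
  consider "j = 0" | "j = n" "0 < n" | p where "j = Suc p" "Suc p < n"
    using j(1) n by (metis Suc_pred le_neq_implies_less not_gr_zero)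
  then have "A \<le> M * h ^ 3 / 24"
  proof cases
    case 1
    then have "A \<le> \<bar>2 * z 0 + z (Suc 0)\<bar>" using le[of "Suc 0"] n j(2) by auto
    then show ?thesis using end_bound[OF l] k[of 0] n by auto
  next
    case 2
    then have "A \<le> \<bar>z (n - 1) + 2 * z n\<bar>" using le[of "n - 1"] n j(2) by auto
    then show ?thesis using end_bound[OF r] k[of "n - 1"] n by auto
  next
    case (3 i)
    define p q where "p = k i" and "q = k (Suc i)"
    have pq: "0 < p" "0 < q" "p \<le> h" "q \<le> h" using k 3 by (auto simp: p_def q_def)
    have zs: "\<bar>z i\<bar> \<le> A" "\<bar>z (Suc (Suc i))\<bar> \<le> A" "\<bar>z (Suc i)\<bar> = A"
      using le 3 j(2) by auto
    \<comment> \<open>The left-hand side at knot \<open>Suc i\<close>, multiplied by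
      \<open>p * q / 2\<close>.\<close>
    define w where "w = q * (z i + 2 * z (Suc i)) + p * (2 * z (Suc i) + z (Suc (Suc i)))"
    have "24 * \<bar>w\<bar> \<le> M * (p\<^sup>2 + q\<^sup>2) * (p * q)"
    proof -
      have "2 / p * (z i + 2 * z (Suc i)) + 2 / q * (2 * z (Suc i) + z (Suc (Suc i))) = 2 * w / (p * q)"
        using pq by (simp add: w_def field_simps)
      then have "\<bar>2 * w / (p * q)\<bar> \<le> M * (p\<^sup>2 + q\<^sup>2) / 12"
        using m[OF 3(2)] by (simp only: p_def[symmetric] q_def[symmetric])
      then show ?thesis using pq by (simp add: abs_mult field_simps)
    qed
    \<comment> \<open>The diagonal term has modulus \<open>2 * (p + q) * A\<close>, the two others
      together at most \<open>(p + q) * A\<close>.\<close>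
    moreover have "(p + q) * A \<le> \<bar>w\<bar>"
    proof -
      have "\<bar>q * z i\<bar> \<le> q * A" "\<bar>p * z (Suc (Suc i))\<bar> \<le> p * A"
        using pq zs by (auto simp: abs_mult)
      moreover have "\<bar>2 * (p + q) * z (Suc i)\<bar> = 2 * (p + q) * A"
        using pq zs by (simp add: abs_mult)
      moreover have "w = 2 * (p + q) * z (Suc i) + q * z i + p * z (Suc (Suc i))"
        by (simp add: w_def algebra_simps)
      ultimately have "2 * ((p + q) * A) - (q * A + p * A) \<le> \<bar>w\<bar>" by linarith
      then show ?thesis by (simp add: algebra_simps)
    qed
    moreover have "(p\<^sup>2 + q\<^sup>2) * (p * q) \<le> (p + q) * h ^ 3"
    proof -
      have "p * p * q \<le> h * h * h" "p * q * q \<le> h * h * h" using pq by (intro mult_mono; simp)+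
      then have "p * (p * p * q) \<le> p * h ^ 3" "q * (p * q * q) \<le> q * h ^ 3"
        using pq by (auto simp: power3_eq_cube intro!: mult_left_mono)
      then show ?thesis by (simp add: power2_eq_square algebra_simps)
    qed
    then have "M * ((p\<^sup>2 + q\<^sup>2) * (p * q)) \<le> M * ((p + q) * h ^ 3)" using M by (intro mult_left_mono)
    ultimately have "(p + q) * (24 * A) \<le> (p + q) * (M * h ^ 3)" by (simp add: algebra_simps)
    then show ?thesis using pq by (simp add: mult_le_cancel_left_pos)
  qed
  then show ?thesis using le[OF i] by simp
qed

section \<open>Error of interpolating cubic splines\<close>

text \<open>One-sided derivatives on a nondegenerate interval are unique, also at its end points.
  Hence slope and second derivative of a spline at a knot can be read off either adjacent
  cubic.\<close>

lemma deriv_chain_eq_poly: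
  assumes F: "deriv_chain m F {a..b}" and ab: "a < b"
    and eq: "\<And>t. t \<in> {a..b} \<Longrightarrow> F 0 t = poly P t"
  shows "j \<le> m \<Longrightarrow> t \<in> {a..b} \<Longrightarrow> F j t = poly ((pderiv ^^ j) P) t"
proof (induction j arbitrary: t)
  case 0
  then show ?case using eq by simp
next
  case (Suc j)
  have "(F j has_vector_derivative F (Suc j) t) (at t within cbox a b)"
    using F Suc.prems by (simp add: deriv_chain_def flip: has_real_derivative_iff_has_vector_derivative)
  moreover have "(poly ((pderiv ^^ j) P) has_vector_derivative poly ((pderiv ^^ Suc j) P) t)
      (at t within cbox a b)"
    unfolding has_real_derivative_iff_has_vector_derivative[symmetric]
    by (simp add: has_field_derivative_at_within[OF poly_DERIV])
  then have "(F j has_vector_derivative poly ((pderiv ^^ Suc j) P) t) (at t within cbox a b)"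
    by (rule has_vector_derivative_transform[rotated 2]) (use Suc in auto)
  ultimately show ?case
    using vector_derivative_unique_within_closed_interval[of a b t] ab Suc.prems by simp
qed

lemma knot_cell_exists:
  fixes x :: "nat \<Rightarrow> real"
  assumes "0 < n" "t \<in> {x 0..x n}"
  shows "\<exists>i<n. t \<in> {x i..x (Suc i)}"
  using assms
proof (induction n)
  case (Suc n)
  show ?case
  proof (cases "0 < n \<and> t \<le> x n")
    case True
    then show ?thesis using Suc by (auto intro: less_SucI)
  next
    case False
    then show ?thesis using Suc.prems by (intro exI[of _ n]) (cases "n = 0"; auto)
  qed
qed simp

text \<open>Factor out \<open>k * (\<tau> * (1 - \<tau>)) \<le> h / 4\<close>; the remaining factor
  is at most a weighted mean of \<open>\<bar>z0\<bar>\<close> and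
  \<open>\<bar>z1\<bar>\<close>.\<close>

lemma hermite_slopes_bound:
  fixes k h \<tau> z0 z1 E :: real
  assumes "0 \<le> k" "k \<le> h" "0 \<le> \<tau>" "\<tau> \<le> 1" "\<bar>z0\<bar> \<le> E" "\<bar>z1\<bar> \<le> E"
  shows "\<bar>k * (z0 * (\<tau> * (1 - \<tau>)\<^sup>2) - z1 * (\<tau>\<^sup>2 * (1 - \<tau>)))\<bar> \<le> h * E / 4"
proof -
  have "\<bar>z0 * (1 - \<tau>) - z1 * \<tau>\<bar> \<le> \<bar>z0\<bar> * (1 - \<tau>) + \<bar>z1\<bar> * \<tau>"
    using abs_triangle_ineq4[of "z0 * (1 - \<tau>)" "z1 * \<tau>"] assms by (simp add: abs_mult)
  also have "\<dots> \<le> E * (1 - \<tau>) + E * \<tau>" using assms by (intro add_mono mult_right_mono) auto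
  finally have 1: "\<bar>z0 * (1 - \<tau>) - z1 * \<tau>\<bar> \<le> E" by (simp add: algebra_simps)
  have "\<tau> * (1 - \<tau>) \<le> 1 / 4"
    using zero_le_power2[of "1 - 2 * \<tau>"] by (simp add: power2_eq_square algebra_simps)
  with assms have 2: "k * (\<tau> * (1 - \<tau>)) \<le> h * (1 / 4)" by (intro mult_mono) auto
  have "k * (z0 * (\<tau> * (1 - \<tau>)\<^sup>2) - z1 * (\<tau>\<^sup>2 * (1 - \<tau>))) = k * (\<tau> * (1 - \<tau>)) * (z0 * (1 - \<tau>) - z1 * \<tau>)"
    by (simp add: power2_eq_square algebra_simps)
  moreover have "\<bar>k * (\<tau> * (1 - \<tau>)) * (z0 * (1 - \<tau>) - z1 * \<tau>)\<bar>
      = k * (\<tau> * (1 - \<tau>)) * \<bar>z0 * (1 - \<tau>) - z1 * \<tau>\<bar>"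
    using assms by (simp add: abs_mult)
  ultimately have "\<bar>k * (z0 * (\<tau> * (1 - \<tau>)\<^sup>2) - z1 * (\<tau>\<^sup>2 * (1 - \<tau>)))\<bar>
      = k * (\<tau> * (1 - \<tau>)) * \<bar>z0 * (1 - \<tau>) - z1 * \<tau>\<bar>"
    by (simp only:)
  also have "\<dots> \<le> h * (1 / 4) * E" using assms by (intro mult_mono[OF 2 1]) auto
  finally show ?thesis by simp
qed

lemma knots_le:
  fixes x :: "nat \<Rightarrow> real"
  assumes "strict_mono_on {0..n} x" "i \<le> j" "j \<le> n"
  shows "x i \<le> x j"
  using assms strict_mono_onD[of "{0..n}" x i j] by (cases "i = j") auto

lemma mesh_ge:
  assumes "i < n"
  shows "x (Suc i) - x i \<le> mesh n x"
proof -
  have "x (Suc i) - x (Suc i - 1) \<in> (\<lambda>i. x i - x (i - 1)) ` {1..n}" using assms by (intro imageI) auto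
  then show ?thesis unfolding mesh_def by (intro Max_ge) auto
qed

lemma norm_deriv4_ge:
  assumes "C_k_on 4 f {x 0..x n}" "t \<in> {x 0..x n}"
  shows "\<bar>nth_deriv_within {x 0..x n} 4 f t\<bar> \<le> norm_deriv4 n x f"
  unfolding norm_deriv4_def
  using assms by (intro nth_deriv_within_le_Sup) (auto simp: C_k_on_def)

lemma cubic_spline_error:
  fixes n :: nat and x :: "nat \<Rightarrow> real" and f s :: "real \<Rightarrow> real"
  defines "S \<equiv> {x 0..x n}"
  assumes n: "4 \<le> n" and x: "strict_mono_on {0..n} x" and f: "C_k_on 4 f S"
    and s: "cubic_spline n x s" and int: "\<And>i. i \<le> n \<Longrightarrow> s (x i) = f (x i)"
    and dl: "\<bar>nth_deriv_within S 2 s (x 0) - nth_deriv_within S 2 f (x 0)\<bar> \<le> D"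
    and dr: "\<bar>nth_deriv_within S 2 s (x n) - nth_deriv_within S 2 f (x n)\<bar> \<le> D"
    and t: "t \<in> S"
  shows "\<bar>s t - f t\<bar> \<le> 5 / 384 * norm_deriv4 n x f * mesh n x ^ 4 + D * (mesh n x)\<^sup>2 / 16"
proof -
  define F where "F = (\<lambda>j. nth_deriv_within S j f)"
  define G where "G = (\<lambda>j. nth_deriv_within S j s)"
  define M where "M = norm_deriv4 n x f"
  define h where "h = mesh n x"
  define k where "k = (\<lambda>i. x (Suc i) - x i)"
  have FG0: "F 0 = f" "G 0 = s" by (auto simp: F_def G_def nth_deriv_within_def)
  have k: "0 < k i" "k i \<le> h" if "i < n" for i
    using that x mesh_ge[of i n x] strict_mono_onD[OF x, of i "Suc i"] by (auto simp: k_def h_def)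
  have cell: "{x i..x (Suc i)} \<subseteq> S" if "i < n" for i
    using that knots_le[OF x, of 0 i] knots_le[OF x, of "Suc i" n] by (auto simp: S_def)
  have F: "deriv_chain 4 F S" unfolding F_def by (rule deriv_chain_nth_deriv_within[OF f])
  have G: "deriv_chain 2 G S" unfolding G_def
    using s by (intro deriv_chain_nth_deriv_within) (simp add: cubic_spline_def S_def)
  have M: "\<bar>F 4 u\<bar> \<le> M" if "u \<in> S" for u
    using norm_deriv4_ge[of f x n u] f that by (simp add: S_def F_def M_def)
  have "0 \<le> M" using M[OF t] by simp
  have "\<exists>p :: real poly. degree p \<le> 3 \<and> (\<forall>t\<in>{x i..x (Suc i)}. s t = poly p t)" if "i < n" for i
  proof -
    have "Suc i \<in> {1..n}" using that by simp
    with s show ?thesis unfolding cubic_spline_def by fastforce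
  qed
  then obtain P where P: "\<And>i. i < n \<Longrightarrow> degree (P i :: real poly) \<le> 3"
    "\<And>i t. i < n \<Longrightarrow> t \<in> {x i..x (Suc i)} \<Longrightarrow> s t = poly (P i) t"
    by metis
  have GP: "G j u = poly ((pderiv ^^ j) (P i)) u"
    if "i < n" "j \<le> 2" "u \<in> {x i..x (Suc i)}" for i j u
    using deriv_chain_subset[OF G cell[OF that(1)]] k(1)[OF that(1)] P(2)[OF that(1)] that
    by (intro deriv_chain_eq_poly[of 2 G]) (auto simp: k_def FG0)
  define e where "e = (\<lambda>i. G 1 (x i) - F 1 (x i))"
  \<comment> \<open>The same number for both cells meeting at a knot, so it cancels when
    \<open>right\<close> for one cell is combined with \<open>left\<close> for the next.\<close>
  define d where "d = (\<lambda>i. G 2 (x i) - F 2 (x i))"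
  have inner: "\<And>u. u \<in> {x i..x (Suc i)} \<Longrightarrow> \<bar>s u - f u - (e i * (u - x i) * (x (Suc i) - u)\<^sup>2
        - e (Suc i) * (u - x i)\<^sup>2 * (x (Suc i) - u)) / (k i)\<^sup>2\<bar> \<le> M * k i ^ 4 / 384"
    and left: "\<bar>d i + 2 / k i * (2 * e i + e (Suc i))\<bar> \<le> M * (k i)\<^sup>2 / 12"
    and right: "\<bar>d (Suc i) - 2 / k i * (e i + 2 * e (Suc i))\<bar> \<le> M * (k i)\<^sup>2 / 12"
    if i: "i < n" for i
  proof -
    have ab: "x i < x (Suc i)" using k(1)[OF i] by (simp add: k_def)
    have ends: "x i \<in> {x i..x (Suc i)}" "x (Suc i) \<in> {x i..x (Suc i)}" using ab by auto
    have Mi: "\<bar>F 4 u\<bar> \<le> M" if "u \<in> {x i..x (Suc i)}" for u using M cell[OF i] that by blast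
    have Pv: "poly (P i) (x i) = F 0 (x i)" "poly (P i) (x (Suc i)) = F 0 (x (Suc i))"
      using P(2)[OF i ends(1)] P(2)[OF i ends(2)] int[of i] int[of "Suc i"] i by (auto simp: FG0)
    have ee: "e i = poly (pderiv (P i)) (x i) - F 1 (x i)"
        "e (Suc i) = poly (pderiv (P i)) (x (Suc i)) - F 1 (x (Suc i))"
      using GP[OF i _ ends(1), of 1] GP[OF i _ ends(2), of 1] by (auto simp: e_def)
    have dd: "d i = poly (pderiv (pderiv (P i))) (x i) - F 2 (x i)"
        "d (Suc i) = poly (pderiv (pderiv (P i))) (x (Suc i)) - F 2 (x (Suc i))"
      using GP[OF i _ ends(1), of 2] GP[OF i _ ends(2), of 2] by (auto simp: d_def numeral_2_eq_2)
    note C = deriv_chain_subset[OF F cell[OF i]] ab Mi P(1)[OF i] Pv ee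
    show "\<bar>s u - f u - (e i * (u - x i) * (x (Suc i) - u)\<^sup>2
        - e (Suc i) * (u - x i)\<^sup>2 * (x (Suc i) - u)) / (k i)\<^sup>2\<bar> \<le> M * k i ^ 4 / 384"
      if "u \<in> {x i..x (Suc i)}" for u
      using cubic_remainder_value[OF C that] P(2)[OF i that] by (simp add: FG0 k_def)
    show "\<bar>d i + 2 / k i * (2 * e i + e (Suc i))\<bar> \<le> M * (k i)\<^sup>2 / 12"
      using cubic_remainder_left[OF C] by (simp add: dd k_def)
    show "\<bar>d (Suc i) - 2 / k i * (e i + 2 * e (Suc i))\<bar> \<le> M * (k i)\<^sup>2 / 12"
      using cubic_remainder_right[OF C] unfolding dd k_def by linarith
  qed
  have "\<bar>d 0\<bar> \<le> D" "\<bar>d n\<bar> \<le> D" using dl dr by (simp_all add: d_def F_def G_def)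
  from null_spline_slopes_exist[where k = k, OF n k this] obtain \<epsilon> where \<epsilon>:
    "2 / k 0 * (2 * \<epsilon> 0 + \<epsilon> (Suc 0)) = - d 0"
    "2 / k (n - 1) * (\<epsilon> (n - 1) + 2 * \<epsilon> n) = d n"
    "\<And>i. Suc i < n \<Longrightarrow>
      2 / k i * (\<epsilon> i + 2 * \<epsilon> (Suc i)) + 2 / k (Suc i) * (2 * \<epsilon> (Suc i) + \<epsilon> (Suc (Suc i))) = 0"
    "\<And>i \<tau>. i < n \<Longrightarrow> \<tau> \<in> {0..1} \<Longrightarrow>
      \<bar>k i * (\<epsilon> i * (\<tau> * (1 - \<tau>)\<^sup>2) - \<epsilon> (Suc i) * (\<tau>\<^sup>2 * (1 - \<tau>)))\<bar> \<le> D * h\<^sup>2 / 16"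
    by blast
  \<comment> \<open>The null spline carries the end errors \<open>d 0\<close> and
    \<open>d n\<close>. Subtracting its slopes leaves a system whose end equations look as if the
    end conditions were exact.\<close>
  define z where "z = (\<lambda>i. e i - \<epsilon> i)"
  have split: "c * (2 * z i + z j) = c * (2 * e i + e j) - c * (2 * \<epsilon> i + \<epsilon> j)"
    "c * (z i + 2 * z j) = c * (e i + 2 * e j) - c * (\<epsilon> i + 2 * \<epsilon> j)" for c i j
    by (simp_all add: z_def algebra_simps)
  have z: "\<bar>z i\<bar> \<le> M * h ^ 3 / 24" if "i \<le> n" for i
  proof (rule slope_system_bound[where k = k and n = n])
    show "\<bar>2 / k 0 * (2 * z 0 + z (Suc 0))\<bar> \<le> M * (k 0)\<^sup>2 / 12"
      using left[of 0] n unfolding split \<epsilon> by (simp add: add.commute)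
    show "\<bar>2 / k (n - 1) * (z (n - 1) + 2 * z n)\<bar> \<le> M * (k (n - 1))\<^sup>2 / 12"
      using right[of "n - 1"] n unfolding split \<epsilon> by (simp add: abs_minus_commute)
    show "\<bar>2 / k i * (z i + 2 * z (Suc i)) + 2 / k (Suc i) * (2 * z (Suc i) + z (Suc (Suc i)))\<bar>
        \<le> M * ((k i)\<^sup>2 + (k (Suc i))\<^sup>2) / 12" if "Suc i < n" for i
    proof -
      have "M * ((k i)\<^sup>2 + (k (Suc i))\<^sup>2) / 12 = M * (k i)\<^sup>2 / 12 + M * (k (Suc i))\<^sup>2 / 12"
        by (simp add: algebra_simps)
      then show ?thesis
        using right[OF Suc_lessD[OF that]] left[OF that] \<epsilon>(3)[OF that] unfolding split by linarith
    qed
  qed (use k n that \<open>0 \<le> M\<close> in auto)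
  obtain i where i: "i < n" "t \<in> {x i..x (Suc i)}"
    using knot_cell_exists[of n t x] n t by (auto simp: S_def)
  define \<tau> where "\<tau> = (t - x i) / k i"
  have \<tau>: "\<tau> \<in> {0..1}" "t - x i = \<tau> * k i" "x (Suc i) - t = (1 - \<tau>) * k i"
    using i k(1)[OF i(1)] by (auto simp: \<tau>_def k_def field_simps)
  have "(e i * (t - x i) * (x (Suc i) - t)\<^sup>2 - e (Suc i) * (t - x i)\<^sup>2 * (x (Suc i) - t)) / (k i)\<^sup>2 =
      k i * (z i * (\<tau> * (1 - \<tau>)\<^sup>2) - z (Suc i) * (\<tau>\<^sup>2 * (1 - \<tau>)))
    + k i * (\<epsilon> i * (\<tau> * (1 - \<tau>)\<^sup>2) - \<epsilon> (Suc i) * (\<tau>\<^sup>2 * (1 - \<tau>)))"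
    using k(1)[OF i(1)] unfolding \<tau>(2,3) z_def by (simp add: power2_eq_square field_simps)
  moreover have "\<bar>k i * (z i * (\<tau> * (1 - \<tau>)\<^sup>2) - z (Suc i) * (\<tau>\<^sup>2 * (1 - \<tau>)))\<bar> \<le> h * (M * h ^ 3 / 24) / 4"
    using k[OF i(1)] \<tau>(1) z i(1) by (intro hermite_slopes_bound) auto
  moreover have "M * k i ^ 4 / 384 \<le> M * h ^ 4 / 384"
    using k[OF i(1)] \<open>0 \<le> M\<close> by (intro divide_right_mono mult_left_mono power_mono) auto
  ultimately have "\<bar>s t - f t\<bar> \<le> M * h ^ 4 / 384 + h * (M * h ^ 3 / 24) / 4 + D * h\<^sup>2 / 16"
    using inner[OF i] \<epsilon>(4)[OF i(1) \<tau>(1)] by linarith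
  also have "M * h ^ 4 / 384 + h * (M * h ^ 3 / 24) / 4 = 5 / 384 * M * h ^ 4"
    by (simp add: power3_eq_cube power4_eq_xxxx)
  finally show ?thesis by (simp add: M_def h_def)
qed

section \<open>The end conditions of the Q-spline\<close>

text \<open>Each end is treated on its own four cells, with \<open>r i\<close> the distance of the
  \<open>i\<close>-th knot counted from that end. Therefore the fifth derivative matters only on the
  first and the last four cells.\<close>

lemma Q_spline_end_errors:
  fixes n :: nat and x :: "nat \<Rightarrow> real" and f s :: "real \<Rightarrow> real"
  defines "S \<equiv> {x 0..x n}"
  assumes n: "4 \<le> n" and x: "strict_mono_on {0..n} x" and f: "C_k_on 4 f S"
    and s: "Q_spline n x f s" and y: "y \<in> {x 0, x n}"
  shows Q_spline_end_error_4: "\<bar>nth_deriv_within S 2 s y - nth_deriv_within S 2 f y\<bar>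
      \<le> 11 / 6 * norm_deriv4 n x f * (mesh n x)\<^sup>2"
    and Q_spline_end_error_5: "C_k_on 5 f S \<Longrightarrow>
      \<bar>nth_deriv_within S 2 s y - nth_deriv_within S 2 f y\<bar>
        \<le> 5 / 6 * real_of_ereal (norm_deriv5 n x f) * mesh n x ^ 3"
proof -
  define F where "F = (\<lambda>j. nth_deriv_within S j f)"
  have F0: "F 0 = f" by (simp add: F_def nth_deriv_within_def)
  have F: "deriv_chain 4 F S" unfolding F_def by (rule deriv_chain_nth_deriv_within[OF f])
  have M: "\<bar>F 4 u\<bar> \<le> norm_deriv4 n x f" if "u \<in> S" for u
    using norm_deriv4_ge[of f x n u] f that by (simp add: S_def F_def)
  let ?T = "{x 0..x 4} \<union> {x (n - 4)..x n}"
  have sub: "{x 0..x 4} \<subseteq> S" "{x (n - 4)..x n} \<subseteq> S"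
    using knots_le[OF x, of 4 n] knots_le[OF x, of 0 "n - 4"] n by (auto simp: S_def)
  have F5: "deriv_chain 5 F S" if "C_k_on 5 f S"
    unfolding F_def by (rule deriv_chain_nth_deriv_within[OF that])
  have N: "\<bar>F 5 u\<bar> \<le> real_of_ereal (norm_deriv5 n x f)" if "C_k_on 5 f S" "u \<in> ?T" for u
  proof -
    have "continuous_on ?T (nth_deriv_within S 5 f)"
      using that(1) sub by (auto simp: C_k_on_def intro: continuous_on_subset)
    from nth_deriv_within_le_Sup[OF this _ that(2)] show ?thesis
      using that(1) by (simp add: norm_deriv5_def F_def S_def compact_Un)
  qed
  have step: "x i < x (Suc i)" if "i < n" for i
    using strict_mono_onD[OF x, of i "Suc i"] that by auto
  from s obtain p q where
    p: "degree p \<le> 4" "\<And>i. i \<le> 4 \<Longrightarrow> poly p (x i) = f (x i)"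
       "nth_deriv_within S 2 s (x 0) = poly (pderiv (pderiv p)) (x 0)"
    and q: "degree q \<le> 4" "\<And>i. n - 4 \<le> i \<Longrightarrow> i \<le> n \<Longrightarrow> poly q (x i) = f (x i)"
       "nth_deriv_within S 2 s (x n) = poly (pderiv (pderiv q)) (x n)"
    unfolding Q_spline_def interpolating_poly_def S_def by auto
  have *: "\<bar>nth_deriv_within S 2 s y - F 2 y\<bar> \<le> 11 / 6 * norm_deriv4 n x f * (mesh n x)\<^sup>2 \<and>
    (C_k_on 5 f S \<longrightarrow>
      \<bar>nth_deriv_within S 2 s y - F 2 y\<bar> \<le> 5 / 6 * real_of_ereal (norm_deriv5 n x f) * mesh n x ^ 3)"
  proof (cases "y = x 0")
    case True
    have pts: "x 0 + 1 * (x i - x 0) \<in> {x 0..x 4}"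
      "F 0 (x 0 + 1 * (x i - x 0)) = poly p (x 0 + 1 * (x i - x 0))" if "i \<le> 4" for i
      using knots_le[OF x, of 0 i] knots_le[OF x, of i 4] n p(2)[of i] that by (auto simp: F0)
    have r: "x i - x 0 < x (Suc i) - x 0" "x (Suc i) - x 0 \<le> x i - x 0 + mesh n x" if "i < 4" for i
      using step[of i] mesh_ge[of i n x] n that by auto
    have "x 0 \<le> x 4" using knots_le[OF x] n by simp
    note E = deriv_chain_subset[OF F sub(1)] this disjI1[OF refl] disjI1[OF refl] diff_self r pts(1) p(1) pts(2)
    show ?thesis
      using end_deriv2_error_4[OF E] end_deriv2_error_5[OF E deriv_chain_subset[OF F5 sub(1)]] M N sub(1)
      unfolding True p(3) by blast
  next
    case False
    then have y: "y = x n" using y by simp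
    \<comment> \<open>At the right end \<open>\<sigma> = -1\<close>, and the knots are counted
      downwards from \<open>n\<close>.\<close>
    have pts: "x n + - 1 * (x n - x (n - i)) \<in> {x (n - 4)..x n}"
      "F 0 (x n + - 1 * (x n - x (n - i))) = poly q (x n + - 1 * (x n - x (n - i)))" if "i \<le> 4" for i
      using knots_le[OF x, of "n - 4" "n - i"] knots_le[OF x, of "n - i" n] n q(2)[of "n - i"] that
      by (auto simp: F0)
    have r: "x n - x (n - i) < x n - x (n - Suc i)"
      "x n - x (n - Suc i) \<le> x n - x (n - i) + mesh n x" if "i < 4" for i
      using step[of "n - Suc i"] mesh_ge[of "n - Suc i" n x] n that by (auto simp: Suc_diff_Suc)
    have r0: "x n - x (n - 0) = 0" by simp
    have "x (n - 4) \<le> x n" using knots_le[OF x] by simp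
    note E = deriv_chain_subset[OF F sub(2)] this disjI2[OF refl] disjI2[OF refl] r0 r pts(1) q(1) pts(2)
    show ?thesis
      using end_deriv2_error_4[OF E] end_deriv2_error_5[OF E deriv_chain_subset[OF F5 sub(2)]] M N sub(2)
      unfolding y q(3) by blast
  qed
  then show "\<bar>nth_deriv_within S 2 s y - nth_deriv_within S 2 f y\<bar>
      \<le> 11 / 6 * norm_deriv4 n x f * (mesh n x)\<^sup>2"
    by (simp add: F_def)
  show "\<bar>nth_deriv_within S 2 s y - nth_deriv_within S 2 f y\<bar>
        \<le> 5 / 6 * real_of_ereal (norm_deriv5 n x f) * mesh n x ^ 3" if "C_k_on 5 f S"
    using * that by (simp add: F_def)
qed

section \<open>The constant \<open>R\<close> and the conclusion\<close>

text \<open>The factor 2 comes from the fifth derivative, where \<open>5 / 6 = 2 * (5 / 12)\<close>;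
  for the fourth derivative it is slack.\<close>

lemma R_const_bound:
  assumes h: "0 < mesh n x" and M: "0 \<le> norm_deriv4 n x f"
    and 4: "d \<le> 11 / 6 * norm_deriv4 n x f * (mesh n x)\<^sup>2"
    and 5: "C_k_on 5 f {x 0..x n} \<Longrightarrow> d \<le> 5 / 6 * real_of_ereal (norm_deriv5 n x f) * mesh n x ^ 3"
  shows "d \<le> 2 * R_const n x f * norm_deriv4 n x f * (mesh n x)\<^sup>2"
proof (cases "norm_deriv4 n x f = 0")
  case True
  then show ?thesis using 4 by simp
next
  case False
  define M h where "M = norm_deriv4 n x f" and "h = mesh n x"
  have pos: "0 < M" "0 < h" using False assms by (auto simp: M_def h_def)
  have *: "d \<le> 2 * (11 / 6) * M * h\<^sup>2"
  proof -
    have "0 \<le> M * h\<^sup>2" using pos by simp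
    then show ?thesis using 4 unfolding M_def[symmetric] h_def[symmetric] by linarith
  qed
  show ?thesis
  proof (cases "C_k_on 5 f {x 0..x n}")
    case True
    define N where "N = real_of_ereal (norm_deriv5 n x f)"
    have N: "norm_deriv5 n x f = ereal N" using True by (simp add: N_def norm_deriv5_def)
    have "R_const n x f = min (11 / 6) (5 * h * N / (12 * M))"
      using pos by (simp add: R_const_def N min_def flip: M_def h_def)
    moreover have "d \<le> 2 * (5 * h * N / (12 * M)) * M * h\<^sup>2"
      using 5[OF True] pos by (simp add: power2_eq_square power3_eq_cube mult_ac flip: N_def h_def)
    ultimately show ?thesis using * by (auto simp: min_def simp flip: M_def h_def)
  next
    case False
    \<comment> \<open>As \<open>h\<close> and \<open>M\<close> are positive, the extended quotient
      is infinite.\<close>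
    then have "R_const n x f = 11 / 6"
      using pos by (simp add: R_const_def norm_deriv5_def flip: M_def h_def)
    then show ?thesis using * by (simp only: M_def[symmetric] h_def[symmetric])
  qed
qed

theorem theorem2:
  fixes n :: nat and x :: "nat \<Rightarrow> real" and f s :: "real \<Rightarrow> real"
  assumes "n \<ge> 4"
    and "strict_mono_on {0..n} x"
    and "C_k_on 4 f {x 0..x n}"
    and "Q_spline n x f s"
  shows "\<forall>t\<in>{x 0..x n}.
    \<bar>s t - f t\<bar> \<le> (5 / 384 + R_const n x f / 8) * norm_deriv4 n x f * mesh n x ^ 4"
proof
  fix t assume t: "t \<in> {x 0..x n}"
  have "0 < mesh n x"
    using mesh_ge[of 0 n x] strict_mono_onD[OF assms(2), of 0 "Suc 0"] assms(1) by force
  moreover have "0 \<le> norm_deriv4 n x f" using norm_deriv4_ge[OF assms(3) t] by linarith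
  ultimately have D: "\<bar>nth_deriv_within {x 0..x n} 2 s y - nth_deriv_within {x 0..x n} 2 f y\<bar>
      \<le> 2 * R_const n x f * norm_deriv4 n x f * (mesh n x)\<^sup>2" if "y \<in> {x 0, x n}" for y
    using Q_spline_end_error_4[OF assms that] Q_spline_end_error_5[OF assms that]
    by (intro R_const_bound)
  \<comment> \<open>Here \<open>D\<close> is \<open>2 * R * M * h\<^sup>2\<close>, with
    \<open>M\<close> the norm of the fourth derivative and \<open>h\<close> the mesh, so
    \<open>D * h\<^sup>2 / 16\<close> is \<open>R / 8 * M * h ^ 4\<close>.\<close>
  have "\<bar>s t - f t\<bar> \<le> 5 / 384 * norm_deriv4 n x f * mesh n x ^ 4
      + 2 * R_const n x f * norm_deriv4 n x f * (mesh n x)\<^sup>2 * (mesh n x)\<^sup>2 / 16"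
    using assms D t by (intro cubic_spline_error) (auto simp: Q_spline_def)
  then show "\<bar>s t - f t\<bar> \<le> (5 / 384 + R_const n x f / 8) * norm_deriv4 n x f * mesh n x ^ 4"
    by (simp add: power2_eq_square power4_eq_xxxx algebra_simps)
qed

end
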